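(* Let $0<p,q\leq\infty$ and $\beta\in\mathbb{R}$. Then $T^{p,q}_{q,\beta}=T^p_{q,\beta}$ as sets, with equivalence of quasi-norms: there are constants $0<c\le C<\infty$ (depending on $n,p,q$ and the fixed Whitney parameters) such that $c\|f\|_{T^p_{q,\beta}}\le \|f\|_{T^{p,q}_{q,\beta}}\le C\|f\|_{T^p_{q,\beta}}$ for all measurable $f$. In particular $T^{p,q}_{q}=T^p_q$ for all $0<p,q\le\infty$.
   Context: Let $\mathbb{R}^{n+1}_+=\mathbb{R}^n\times(0,\infty)$ with Lebesgue measure; functions are complex-valued measurable functions on $\mathbb{R}^{n+1}_+$, identified when equal a.e. For $(y,t)\in\mathbb{R}^{n+1}_+$ let $B(y,t)=\{z\in\mathbb{R}^n:|z-y|<t\}$. The cone with vertex $x\in\mathbb{R}^n$ is $\Gamma(x)=\{(y,t):|y-x|<t\}$ and the tent over an open ball $B\subset\mathbb{R}^n$ is $\widehat{B}=\{(y,t):B(y,t)\subset B\}$. Fix Whitney parameters $(\alpha_1,\alpha_2)$ with $0<\alpha_1<\alpha_2^{-1}<1$, and set $W(y,t)=\{(z,s):|z-y|<\alpha_1t,\ \alpha_2^{-1}t<s<\alpha_2t\}$. For $0<r<\infty$, $\mathcal{W}_r(f)(y,t)=|W(y,t)|^{-1/r}\|f\|_{L^r(W(y,t))}$, and $\mathcal{W}_\infty(f)(y,t)=\operatorname{ess\,sup}_{W(y,t)}|f|$. Tent spaces $T^p_q$ ($0<p,q\le\infty$): (A) if $p,q<\infty$, $\|g\|_{T^p_q}=\|\mathcal{A}_q(g)\|_{L^p(\mathbb{R}^n)}$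 with $\mathcal{A}_q(g)(x)=(\iint_{\Gamma(x)}|g(y,t)|^q\,dy\,dt/t^{n+1})^{1/q}$; (B) if $q<p=\infty$, $\|g\|_{T^\infty_q}=\|\mathcal{C}_q(g)\|_{L^\infty}$ with $\mathcal{C}_q(g)(x)=\sup_{B\ni x}|B|^{-1/q}(\iint_{\widehat B}|g|^q\,dy\,dt/t)^{1/q}$ (sup over open balls $B$); (C) if $p<q=\infty$, $\|g\|_{T^p_\infty}=\|\mathcal{N}(g)\|_{L^p}$ with $\mathcal{N}(g)(x)=\sup_{(y,t)\in\Gamma(x)}|g(y,t)|$ (no continuity required); (D) $T^\infty_\infty=L^\infty(\mathbb{R}^{n+1}_+)$. In each case $T^p_q$ is the set of $g$ with finite quasi-norm. For $\beta\in\mathbb{R}$: $\|g\|_{T^p_{q,\beta}}=\|g(y,t)t^{-\beta}\|_{T^p_q}$. For $0<r\le\infty$: $\|f\|_{T^{p,r}_q}=\|\mathcal{W}_r(f)\|_{T^p_q}$ and $\|f\|_{T^{p,r}_{q,\beta}}=\|f(z,s)s^{-\beta}\|_{T^{p,r}_q}$; the spaces consist of the (locally $L^q$, resp. $L^r$) functions with finite quasi-norm. *)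

theory Defs
  imports "HOL-Analysis.Analysis"
begin

text \<open>Upper half space R^n x (0,oo) is modelled as pairs (y,t) :: 'a \<times> real with
  'a a Euclidean space of dimension n = DIM('a); only points with t > 0 are ever used.
  Exponents p, q, r range over (0, oo], modelled as ennreal values with top = oo.
  All (quasi-)norms take values in ennreal (possibly infinite).\<close>

definition epow :: "ennreal \<Rightarrow> real \<Rightarrow> ennreal" where
  "epow x r = (if x = top then top else ennreal (enn2real x powr r))"

definition ess_sup_on :: "'b::euclidean_space set \<Rightarrow> ('b \<Rightarrow> ennreal) \<Rightarrow> ennreal" where
  "ess_sup_on A F = Inf {C. AE x in lebesgue. x \<in> A \<longrightarrow> F x \<le> C}"

definition Lp_norm :: "ennreal \<Rightarrow> ('a::euclidean_space \<Rightarrow> ennreal) \<Rightarrow> ennreal" where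
  "Lp_norm p F = (if p = (top::ennreal) then ess_sup_on UNIV F
     else epow (\<integral>\<^sup>+ x. epow (F x) (enn2real p) \<partial>lebesgue) (1 / enn2real p))"

definition half_space :: "('a::euclidean_space \<times> real) set" where
  "half_space = {(y, t). 0 < t}"

definition cone :: "'a::euclidean_space \<Rightarrow> ('a \<times> real) set" where
  "cone x = {(y, t). dist y x < t}"

definition tent :: "'a::euclidean_space set \<Rightarrow> ('a \<times> real) set" where
  "tent B = {(y, t). 0 < t \<and> ball y t \<subseteq> B}"

definition whitney :: "real \<Rightarrow> real \<Rightarrow> 'a::euclidean_space \<times> real \<Rightarrow> ('a \<times> real) set" where
  "whitney \<alpha>1 \<alpha>2 = (\<lambda>(y, t). {(z, s). dist z y < \<alpha>1 * t \<and> t / \<alpha>2 < s \<and> s < \<alpha>2 * t})"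

text \<open>Whitney average W_r(f)(y,t); here F stands for |f|.\<close>
definition whitney_avg :: "real \<Rightarrow> real \<Rightarrow> ennreal \<Rightarrow> ('a::euclidean_space \<times> real \<Rightarrow> ennreal)
    \<Rightarrow> 'a \<times> real \<Rightarrow> ennreal" where
  "whitney_avg \<alpha>1 \<alpha>2 r F = (\<lambda>yt.
     if r = top then ess_sup_on (whitney \<alpha>1 \<alpha>2 yt) F
     else epow ((\<integral>\<^sup>+ zs \<in> whitney \<alpha>1 \<alpha>2 yt. epow (F zs) (enn2real r) \<partial>lebesgue)
                 / emeasure lebesgue (whitney \<alpha>1 \<alpha>2 yt)) (1 / enn2real r))"

definition area_fn :: "ennreal \<Rightarrow> ('a::euclidean_space \<times> real \<Rightarrow> ennreal) \<Rightarrow> 'a \<Rightarrow> ennreal" where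
  "area_fn q G x = epow (\<integral>\<^sup>+ (y, t) \<in> cone x.
       epow (G (y, t)) (enn2real q) / ennreal (t ^ (DIM('a) + 1)) \<partial>lebesgue) (1 / enn2real q)"

definition carleson_fn :: "ennreal \<Rightarrow> ('a::euclidean_space \<times> real \<Rightarrow> ennreal) \<Rightarrow> 'a \<Rightarrow> ennreal" where
  "carleson_fn q G x = (SUP B \<in> {ball c \<rho> | c \<rho>. 0 < \<rho> \<and> x \<in> ball c \<rho>}.
       epow (emeasure lebesgue B) (- 1 / enn2real q) *
       epow (\<integral>\<^sup>+ (y, t) \<in> tent B. epow (G (y, t)) (enn2real q) / ennreal t \<partial>lebesgue) (1 / enn2real q))"

text \<open>Nontangential maximal functional N (essential supremum over the cone, so that it is
  well defined on a.e.-classes).\<close>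
definition ntmax_fn :: "('a::euclidean_space \<times> real \<Rightarrow> ennreal) \<Rightarrow> 'a \<Rightarrow> ennreal" where
  "ntmax_fn G x = ess_sup_on (cone x) G"

text \<open>Tent space quasi-norm ||G||_{T^p_q} of a nonnegative function G (standing for |g|).\<close>
definition tent_norm :: "ennreal \<Rightarrow> ennreal \<Rightarrow> ('a::euclidean_space \<times> real \<Rightarrow> ennreal) \<Rightarrow> ennreal" where
  "tent_norm p q G =
     (if p < top \<and> q < top then Lp_norm p (area_fn q G)
      else if p = top \<and> q < top then Lp_norm top (carleson_fn q G)
      else if p < top \<and> q = top then Lp_norm p (ntmax_fn G)
      else ess_sup_on half_space G)"

definition tent_norm_w :: "ennreal \<Rightarrow> ennreal \<Rightarrow> real \<Rightarrow> ('a::euclidean_space \<times> real \<Rightarrow> complex) \<Rightarrow> ennreal" where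
  "tent_norm_w p q \<beta> g = tent_norm p q (\<lambda>(y, t). ennreal (cmod (g (y, t)) * t powr (- \<beta>)))"

definition tent_norm_whitney :: "real \<Rightarrow> real \<Rightarrow> ennreal \<Rightarrow> ennreal \<Rightarrow> ennreal \<Rightarrow> real
    \<Rightarrow> ('a::euclidean_space \<times> real \<Rightarrow> complex) \<Rightarrow> ennreal" where
  "tent_norm_whitney \<alpha>1 \<alpha>2 p r q \<beta> f =
     tent_norm p q (whitney_avg \<alpha>1 \<alpha>2 r (\<lambda>(z, s). ennreal (cmod (f (z, s)) * s powr (- \<beta>))))"

end

theory Submission
  imports Defs
begin

text \<open>For \<open>q < \<infinity>\<close>, Tonelli turns the cone (or tent) integral of the \<open>q\<close>-th power of the Whitney
  average into an integral of \<open>|f|\<^sup>q\<close> against a kernel which, since \<open>t\<close> and \<open>s\<close> are comparable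
  whenever \<open>(z, s) \<in> W(y, t)\<close>, has the size of the original weight. It lives on a wider cone
  (or a dilated tent), and is bounded below on the original one. This settles \<open>p = \<infinity>\<close> and gives
  pointwise bounds between area functionals; for \<open>q = \<infinity>\<close> the bounds hold between the
  nontangential maximal functionals because Whitney boxes are open neighbourhoods of their centres.

  What remains for \<open>p < \<infinity>\<close> is the change of aperture. Off the set where the maximal function of
  the indicator of \<open>U\<close> is large, every ball in a wide cone keeps at least half of its shrunken
  copy outside \<open>U\<close>; with \<open>U = {A > \<lambda>}\<close> this compares distribution functions, which suffices for
  the maximal functional and for the area functional when \<open>p < q\<close>. For \<open>p > q\<close> one pairs the wide
  area functional with a power of itself and moves the dilation onto the maximal function.\<close>

section \<open>Powers and essential suprema\<close>

text \<open>Three ranges of r = p/q appear because the area functional to the power p is the r-th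
  power of a cone integral of |f|^q. The comparison of level sets produces, at height t, the
  integral of A over {A \<le> t}; weighted by t^(r-2) it converges at infinity only for r < 1. At r
  = 1 Tonelli gives an identity up to the factor a^n, and r > 1 is the range where the maximal
  function is bounded at the dual exponent. For p < \<infinity> only one of the two inequalities
  involves the aperture: a box centred in a cone may leave it, whereas every point of a cone lies in
  enough boxes centred in the same cone. For p = \<infinity> the loss is a dilation of the ball,
  absorbed by the supremum over all balls. The weight t^(-\<beta>) is part of the function
  throughout, so no constant sees \<beta>. Measurability of a Whitney average in its centre is never
  established: averages enter through monotonicity of the integral, or are unfolded and treated by
  Tonelli.\<close>

lemma epow_0 [simp]: "epow 0 r = 0"
  and epow_top [simp]: "epow top r = top"
  and epow_1 [simp]: "epow x 1 = x"
  and epow_ennreal: "0 \<le> u \<Longrightarrow> epow (ennreal u) r = ennreal (u powr r)"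
  by (auto simp: epow_def less_top)

lemma epow_mono: "x \<le> y \<Longrightarrow> 0 \<le> r \<Longrightarrow> epow x r \<le> epow y r"
  unfolding epow_def
  by (auto simp: top_unique less_top intro!: ennreal_leI powr_mono2 enn2real_mono)

lemma epow_epow [simp]: "epow (epow x a) b = epow x (a * b)"
  by (auto simp: epow_def powr_powr)

text \<open>With 0 and \<open>top\<close> fixed by every power and 0 * \<open>top\<close> = 0, this
  holds for all real exponents, negative ones included; the Carleson normalisation uses the exponent
  -1/q.\<close>

lemma epow_mult: "epow (x * y) r = epow x r * epow y r"
proof (cases "x = 0 \<or> y = 0")
  case False
  then have nz: "epow x r \<noteq> 0" "epow y r \<noteq> 0"
    by (auto simp: epow_def ennreal_eq_0_iff enn2real_eq_0_iff)
  show ?thesis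
  proof (cases "x = top \<or> y = top")
    case True
    with False nz show ?thesis by (elim disjE) simp_all
  next
    case False
    then obtain u v where "x = ennreal u" "0 \<le> u" "y = ennreal v" "0 \<le> v"
      by (metis ennreal_cases)
    then show ?thesis
      by (simp add: epow_ennreal powr_mult ennreal_mult[symmetric])
  qed
qed auto

lemma measurable_epow [measurable]:
  assumes [measurable]: "f \<in> borel_measurable M"
  shows "(\<lambda>x. epow (f x) r) \<in> borel_measurable M"
  unfolding epow_def by measurable

lemma AE_lebesgue_iff: "(AE x in lebesgue. P x) \<longleftrightarrow> (AE x in lborel. P x)"
  by (rule AE_completion_iff)

text \<open>The infimum is attained: it is already the infimum of a sequence of admissible bounds,
  and a countable union of null sets is null.\<close>

lemma AE_ess_sup_on: "AE x in lebesgue. x \<in> A \<longrightarrow> F x \<le> ess_sup_on A F"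
proof -
  let ?S = "{C. AE x in lebesgue. x \<in> A \<longrightarrow> F x \<le> C}"
  have "?S \<noteq> {}" by (auto intro!: exI[of _ top])
  then obtain f :: "nat \<Rightarrow> ennreal" where f: "range f \<subseteq> ?S" "Inf ?S = (INF i. f i)"
    by (rule ennreal_Inf_countable_INF[THEN exE]) blast
  have "AE x in lebesgue. \<forall>i. x \<in> A \<longrightarrow> F x \<le> f i"
    using f(1) by (subst AE_all_countable) auto
  then show ?thesis
    unfolding ess_sup_on_def f(2) by eventually_elim (auto intro: INF_greatest)
qed

lemma ess_sup_on_le_iff: "ess_sup_on A F \<le> C \<longleftrightarrow> (AE x in lebesgue. x \<in> A \<longrightarrow> F x \<le> C)"
proof
  assume "ess_sup_on A F \<le> C"
  then show "AE x in lebesgue. x \<in> A \<longrightarrow> F x \<le> C"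
    using AE_ess_sup_on[of A F] by (auto elim: eventually_mono)
qed (auto simp: ess_sup_on_def intro: Inf_lower)

lemma ess_sup_on_mono:
  "(\<And>x. x \<in> A \<Longrightarrow> F x \<le> G x) \<Longrightarrow> ess_sup_on A F \<le> ess_sup_on A G"
  unfolding ess_sup_on_le_iff using AE_ess_sup_on[of A G]
  by eventually_elim (auto intro: order_trans)

lemma ess_sup_on_cong_AE:
  assumes "AE x in lebesgue. F x = G x"
  shows "ess_sup_on A F = ess_sup_on A G"
proof (intro antisym)
  show "ess_sup_on A F \<le> ess_sup_on A G"
    unfolding ess_sup_on_le_iff using AE_ess_sup_on[of A G] assms
    by eventually_elim auto
  show "ess_sup_on A G \<le> ess_sup_on A F"
    unfolding ess_sup_on_le_iff using AE_ess_sup_on[of A F] assms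
    by eventually_elim auto
qed

text \<open>Superlevel set of the uncentred Hardy-Littlewood maximal function, written as a union of
  balls: this makes it visibly open and is the form in which a covering lemma applies.\<close>

definition max_set :: "('a::euclidean_space \<Rightarrow> ennreal) \<Rightarrow> ennreal \<Rightarrow> 'a set" where
  "max_set h l = \<Union>{ball c \<rho> | c \<rho>. 0 < \<rho> \<and> l * emeasure lborel (ball c \<rho>) < (\<integral>\<^sup>+x\<in>ball c \<rho>. h x \<partial>lborel)}"

lemma mem_max_set:
  "x \<in> max_set h l \<longleftrightarrow> (\<exists>c \<rho>. 0 < \<rho> \<and> x \<in> ball c \<rho> \<and>
     l * emeasure lborel (ball c \<rho>) < (\<integral>\<^sup>+z\<in>ball c \<rho>. h z \<partial>lborel))"
  unfolding max_set_def by blast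

lemma open_max_set: "open (max_set h l)"
  unfolding max_set_def by auto

lemma max_set_measurable [measurable]: "max_set h l \<in> sets borel"
  using open_max_set by (rule borel_open)

lemma emeasure_ball_scale:
  fixes c d :: "'a::euclidean_space"
  assumes "0 \<le> k" "0 \<le> \<rho>"
  shows "emeasure lborel (ball c (k * \<rho>)) = ennreal (k ^ DIM('a)) * emeasure lborel (ball d \<rho>)"
  using assms by (simp add: emeasure_ball power_mult_distrib ennreal_mult'' ennreal_mult' mult_ac)

text \<open>Vitali covering: among the balls that make up \<open>max_set\<close> there is a
  countable disjoint subfamily whose fivefold dilates still cover. Each dilate has 5^n times the
  measure of its ball, and disjointness lets the integrals of h add up to at most the full
  integral.\<close>

lemma weak_type_maximal:
  fixes h :: "'a::euclidean_space \<Rightarrow> ennreal"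
  assumes [measurable]: "h \<in> borel_measurable borel" and l: "0 < l"
  shows "ennreal l * emeasure lborel (max_set h (ennreal l))
           \<le> ennreal (5 ^ DIM('a)) * (\<integral>\<^sup>+x. h x \<partial>lborel)"
proof (cases "(\<integral>\<^sup>+x. h x \<partial>lborel) = top")
  case True
  then show ?thesis by (simp add: ennreal_mult_top)
next
  case False
  define I where "I = enn2real (\<integral>\<^sup>+x. h x \<partial>lborel)"
  have I: "(\<integral>\<^sup>+x. h x \<partial>lborel) = ennreal I" "0 \<le> I"
    using False by (auto simp: I_def less_top)
  define K where "K = {(c::'a, \<rho>). 0 < \<rho> \<and> ennreal l * emeasure lborel (ball c \<rho>) < (\<integral>\<^sup>+x\<in>ball c \<rho>. h x \<partial>lborel)}"
  have K: "max_set h (ennreal l) \<subseteq> (\<Union>i\<in>K. ball (fst i) (snd i))"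
    unfolding max_set_def K_def by fastforce
  define v where "v = unit_ball_vol (real DIM('a))"
  have v: "v > 0" by (simp add: v_def)
  \<comment> \<open>The covering lemma asks for bounded radii. A ball of the family satisfies l v
    \<rho>^n < I, and if \<rho> > 1 then \<rho> \<le> \<rho>^n, which gives \<rho> < I / (l
    v).\<close>
  define B where "B = max 1 (I / (l * v))"
  have bd: "0 < snd i \<and> snd i \<le> B" if i: "i \<in> K" for i
  proof -
    obtain c \<rho> where [simp]: "i = (c, \<rho>)" by (cases i)
    have \<rho>: "0 < \<rho>" and lt: "ennreal l * emeasure lborel (ball c \<rho>) < (\<integral>\<^sup>+x\<in>ball c \<rho>. h x \<partial>lborel)"
      using i by (auto simp: K_def)
    have "(\<integral>\<^sup>+x\<in>ball c \<rho>. h x \<partial>lborel) \<le> (\<integral>\<^sup>+x. h x \<partial>lborel)"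
      by (intro nn_integral_mono) (auto simp: indicator_def)
    with lt have "ennreal (l * (v * \<rho> ^ DIM('a))) < ennreal I"
      using \<rho> l v by (simp add: emeasure_ball ennreal_mult v_def I(1)[symmetric])
    then have *: "l * (v * \<rho> ^ DIM('a)) < I"
      using l v \<rho> by (subst (asm) ennreal_less_iff) auto
    have "\<rho> \<le> B"
    proof (rule ccontr)
      assume "\<not> \<rho> \<le> B"
      then have "1 < \<rho>" "I / (l * v) < \<rho>" by (auto simp: B_def)
      moreover have "\<rho> ^ 1 \<le> \<rho> ^ DIM('a)"
        using \<open>1 < \<rho>\<close> by (intro power_increasing) (auto simp: DIM_positive Suc_leI)
      ultimately have "I < (l * v) * \<rho>" "\<rho> \<le> \<rho> ^ DIM('a)"
        using l v by (simp_all add: divide_less_eq mult_ac)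
      moreover from this(2) have "(l * v) * \<rho> \<le> (l * v) * \<rho> ^ DIM('a)"
        using l v by (intro mult_left_mono) auto
      ultimately show False
        using * by (simp add: mult_ac)
    qed
    with \<rho> show ?thesis by simp
  qed
  obtain C where C: "countable C" "C \<subseteq> K"
     "pairwise (\<lambda>i j. disjnt (ball (fst i) (snd i)) (ball (fst j) (snd j))) C"
     "max_set h (ennreal l) \<subseteq> (\<Union>i\<in>C. ball (fst i) (5 * snd i))"
    using Vitali_covering_lemma_balls[OF K bd] by blast
  define N where "N = to_nat_on C ` C"
  define b where "b k i = (if i \<in> N then ball (fst (from_nat_into C i)) (k * snd (from_nat_into C i)) else {})"
    for k i
  have b: "from_nat_into C i \<in> C" if "i \<in> N" for i
    using that C(1) by (auto simp: N_def)
  have [measurable]: "b k i \<in> sets borel" for k i by (auto simp: b_def)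
  have disj: "disjoint_family (b 1)"
    unfolding disjoint_family_on_def
  proof safe
    fix i j x assume ij: "i \<noteq> j" "x \<in> b 1 i" "x \<in> b 1 j"
    then have "i \<in> N" "j \<in> N" by (auto simp: b_def split: if_splits)
    then have "from_nat_into C i \<noteq> from_nat_into C j"
      using ij(1) C(1) by (auto simp: N_def)
    with pairwiseD[OF C(3)] b \<open>i \<in> N\<close> \<open>j \<in> N\<close>
    have "disjnt (ball (fst (from_nat_into C i)) (snd (from_nat_into C i)))
                 (ball (fst (from_nat_into C j)) (snd (from_nat_into C j)))" by blast
    with ij \<open>i \<in> N\<close> \<open>j \<in> N\<close> show "x \<in> {}"
      unfolding disjnt_def b_def by (simp del: mem_ball) blast
  qed
  have cov: "max_set h (ennreal l) \<subseteq> (\<Union>i. b 5 i)"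
  proof
    fix x assume "x \<in> max_set h (ennreal l)"
    then obtain i where i: "i \<in> C" "x \<in> ball (fst i) (5 * snd i)" using C(4) by blast
    then have "x \<in> b 5 (to_nat_on C i)"
      using C(1) by (auto simp: b_def N_def)
    then show "x \<in> (\<Union>i. b 5 i)" by blast
  qed
  have scale: "ennreal l * emeasure lborel (b 5 i) \<le> ennreal (5 ^ DIM('a)) * (\<integral>\<^sup>+x\<in>b 1 i. h x \<partial>lborel)" for i
  proof (cases "i \<in> N")
    case True
    obtain c \<rho> where c: "from_nat_into C i = (c, \<rho>)" by (cases "from_nat_into C i")
    then have "(c, \<rho>) \<in> K" using b[OF True] C(2) by auto
    then have \<rho>: "0 < \<rho>" and lt: "ennreal l * emeasure lborel (ball c \<rho>) \<le> (\<integral>\<^sup>+x\<in>ball c \<rho>. h x \<partial>lborel)"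
      by (auto simp: K_def)
    have "ennreal l * emeasure lborel (ball c (5 * \<rho>)) =
          ennreal (5 ^ DIM('a)) * (ennreal l * emeasure lborel (ball c \<rho>))"
      using \<rho> by (subst emeasure_ball_scale[of 5 \<rho> c c]) (auto simp: mult_ac)
    also have "\<dots> \<le> ennreal (5 ^ DIM('a)) * (\<integral>\<^sup>+x\<in>ball c \<rho>. h x \<partial>lborel)"
      using lt by (rule mult_left_mono) simp
    finally show ?thesis using True c by (simp add: b_def)
  qed (simp add: b_def)
  have "ennreal l * emeasure lborel (max_set h (ennreal l)) \<le> ennreal l * (\<Sum>i. emeasure lborel (b 5 i))"
    by (intro mult_left_mono order_trans[OF emeasure_mono[OF cov] emeasure_subadditive_countably]) auto
  also have "\<dots> \<le> (\<Sum>i. ennreal (5 ^ DIM('a)) * (\<integral>\<^sup>+x\<in>b 1 i. h x \<partial>lborel))"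
    unfolding ennreal_suminf_cmult[symmetric] by (intro suminf_le scale) auto
  also have "\<dots> = ennreal (5 ^ DIM('a)) * (\<integral>\<^sup>+x\<in>(\<Union>i. b 1 i). h x \<partial>lborel)"
    using disj by (simp add: nn_integral_disjoint_family)
  also have "\<dots> \<le> ennreal (5 ^ DIM('a)) * (\<integral>\<^sup>+x. h x \<partial>lborel)"
    by (intro mult_left_mono nn_integral_mono) (auto simp: indicator_def)
  finally show ?thesis .
qed

section \<open>Distribution functions\<close>

lemma layer_cake:
  assumes r: "0 < r"
  shows "(\<integral>\<^sup>+t\<in>{t. 0 < t \<and> ennreal t < u}. ennreal (r * t powr (r - 1)) \<partial>lborel) = epow u r"
proof -
  have *: "(\<integral>\<^sup>+t\<in>{t. 0 < t \<and> ennreal t < ennreal v}. ennreal (r * t powr (r - 1)) \<partial>lborel) = epow (ennreal v) r"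
    if v: "0 \<le> v" for v
  proof -
    have "((\<lambda>t. r * t powr (r - 1)) has_integral (r * (v powr (r - 1 + 1) / (r - 1 + 1)))) {0..v}"
      using r v by (intro has_integral_mult_right has_integral_powr_from_0) auto
    then have "((\<lambda>t. r * t powr (r - 1)) has_integral v powr r) {0..v}"
      using r by simp
    then have "(\<integral>\<^sup>+t\<in>{0..v}. ennreal (r * t powr (r - 1)) \<partial>lborel) = ennreal (v powr r)"
      using r by (intro nn_integral_has_integral_lebesgue') auto
    moreover have "(\<integral>\<^sup>+t\<in>{t. 0 < t \<and> ennreal t < ennreal v}. ennreal (r * t powr (r - 1)) \<partial>lborel)
        = (\<integral>\<^sup>+t\<in>{0..v}. ennreal (r * t powr (r - 1)) \<partial>lborel)"
    proof (rule nn_integral_cong_AE)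
      have "AE t in lborel. t \<noteq> 0 \<and> t \<noteq> v"
        using AE_lborel_singleton[of 0] AE_lborel_singleton[of v] by eventually_elim auto
      then show "AE t in lborel. ennreal (r * t powr (r - 1)) * indicator {t. 0 < t \<and> ennreal t < ennreal v} t
          = ennreal (r * t powr (r - 1)) * indicator {0..v} t"
        by eventually_elim (auto simp: indicator_def ennreal_less_iff)
    qed
    ultimately show ?thesis using v by (simp add: epow_ennreal)
  qed
  show ?thesis
  proof (cases u)
    case (real v)
    then show ?thesis using * by simp
  next
    case top
    let ?I = "\<integral>\<^sup>+t\<in>{t. 0 < t \<and> ennreal t < top}. ennreal (r * t powr (r - 1)) \<partial>lborel"
    have "?I = top"
    proof (rule ccontr)
      assume "?I \<noteq> top"
      then obtain c where c: "?I = ennreal c" "0 \<le> c" by (cases ?I) auto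
      \<comment> \<open>If the integral over all levels were a finite c, stopping at the level whose
        r-th power is c + 1 would already exceed it.\<close>
      have "epow (ennreal ((c + 1) powr (1 / r))) r \<le> ?I"
        unfolding *[OF powr_ge_zero, symmetric]
        by (intro nn_integral_mono mult_left_mono) (auto simp: indicator_def)
      also have "epow (ennreal ((c + 1) powr (1 / r))) r = ennreal (c + 1)"
        using c r by (simp add: epow_ennreal powr_powr)
      finally show False using c by (simp add: ennreal_le_iff)
    qed
    with top show ?thesis by simp
  qed
qed

text \<open>Turns a bound for distribution functions into a bound of r-th powers.
  \<open>\<Phi> t u\<close> is what a point with g = u contributes at level t. The level-set bound
  comes multiplied by t, as weak-type and Chebyshev estimates provide it, so the layer-cake density
  r t^(r-1) leaves r t^(r-2). Tonelli then lets the levels be integrated first, separately at each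
  point.\<close>

lemma nn_integral_epow_le_of_distribution:
  fixes f g :: "'a::euclidean_space \<Rightarrow> ennreal"
  assumes [measurable]: "f \<in> borel_measurable borel" "g \<in> borel_measurable borel"
      "(\<lambda>(t, u). \<Phi> t u) \<in> borel_measurable (borel \<Otimes>\<^sub>M borel)"
    and r: "0 < r"
    and dist: "\<And>t. 0 < t \<Longrightarrow> ennreal t * emeasure lborel {x. ennreal t < f x} \<le> (\<integral>\<^sup>+x. \<Phi> t (g x) \<partial>lborel)"
    and \<Phi>: "\<And>u. (\<integral>\<^sup>+t\<in>{0<..}. ennreal (r * t powr (r - 2)) * \<Phi> t u \<partial>lborel) \<le> C * epow u r"
  shows "(\<integral>\<^sup>+x. epow (f x) r \<partial>lborel) \<le> C * (\<integral>\<^sup>+x. epow (g x) r \<partial>lborel)"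
proof -
  have "(\<integral>\<^sup>+x. epow (f x) r \<partial>lborel) =
      (\<integral>\<^sup>+x. (\<integral>\<^sup>+t. ennreal (r * t powr (r - 1)) * indicator {t. 0 < t \<and> ennreal t < f x} t \<partial>lborel) \<partial>lborel)"
    using r by (simp add: layer_cake)
  also have "\<dots> = (\<integral>\<^sup>+t. (\<integral>\<^sup>+x. ennreal (r * t powr (r - 1)) * indicator {t. 0 < t \<and> ennreal t < f x} t \<partial>lborel) \<partial>lborel)"
    by (rule lborel_pair.Fubini') measurable
  also have "\<dots> \<le> (\<integral>\<^sup>+t. (\<integral>\<^sup>+x. ennreal (r * t powr (r - 2)) * \<Phi> t (g x) * indicator {0<..} t \<partial>lborel) \<partial>lborel)"
  proof (rule nn_integral_mono)
    fix t :: real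
    show "(\<integral>\<^sup>+x. ennreal (r * t powr (r - 1)) * indicator {t. 0 < t \<and> ennreal t < f x} t \<partial>lborel)
        \<le> (\<integral>\<^sup>+x. ennreal (r * t powr (r - 2)) * \<Phi> t (g x) * indicator {0<..} t \<partial>lborel)"
    proof (cases "0 < t")
      case True
      have "(\<integral>\<^sup>+x. ennreal (r * t powr (r - 1)) * indicator {t. 0 < t \<and> ennreal t < f x} t \<partial>lborel)
          = (\<integral>\<^sup>+x. ennreal (r * t powr (r - 1)) * indicator {x. ennreal t < f x} x \<partial>lborel)"
        using True by (intro nn_integral_cong) (auto simp: indicator_def)
      also have "\<dots> = ennreal (r * t powr (r - 1)) * emeasure lborel {x. ennreal t < f x}"
        by (simp add: nn_integral_cmult)
      also have "\<dots> = ennreal (r * t powr (r - 2)) * (ennreal t * emeasure lborel {x. ennreal t < f x})"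
      proof -
        have "r * t powr (r - 1) = r * t powr (r - 2) * t"
          using True powr_add[of t "r - 2" 1] by simp
        then show ?thesis using True r by (simp add: ennreal_mult mult.assoc)
      qed
      also have "\<dots> \<le> ennreal (r * t powr (r - 2)) * (\<integral>\<^sup>+x. \<Phi> t (g x) \<partial>lborel)"
        using dist[OF True] by (rule mult_left_mono) simp
      also have "\<dots> = (\<integral>\<^sup>+x. ennreal (r * t powr (r - 2)) * \<Phi> t (g x) * indicator {0<..} t \<partial>lborel)"
        using True by (simp add: nn_integral_cmult)
      finally show ?thesis .
    qed simp
  qed
  also have "\<dots> = (\<integral>\<^sup>+x. (\<integral>\<^sup>+t. ennreal (r * t powr (r - 2)) * \<Phi> t (g x) * indicator {0<..} t \<partial>lborel) \<partial>lborel)"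
    by (rule lborel_pair.Fubini') measurable
  also have "\<dots> \<le> (\<integral>\<^sup>+x. C * epow (g x) r \<partial>lborel)"
    by (intro nn_integral_mono \<Phi>)
  also have "\<dots> = C * (\<integral>\<^sup>+x. epow (g x) r \<partial>lborel)"
    by (rule nn_integral_cmult) measurable
  finally show ?thesis .
qed

lemma nn_integral_below_level:
  assumes r: "0 < r"
  shows "(\<integral>\<^sup>+t\<in>{0<..}. ennreal (r * t powr (r - 2)) * (ennreal t * indicator {v. ennreal t < v} u) \<partial>lborel) = epow u r"
proof -
  have "(\<integral>\<^sup>+t\<in>{0<..}. ennreal (r * t powr (r - 2)) * (ennreal t * indicator {v. ennreal t < v} u) \<partial>lborel)
      = (\<integral>\<^sup>+t\<in>{t. 0 < t \<and> ennreal t < u}. ennreal (r * t powr (r - 1)) \<partial>lborel)"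
  proof (rule nn_integral_cong)
    fix t :: real
    have "r * t powr (r - 1) = r * t powr (r - 2) * t" if "0 < t"
      using that powr_add[of t "r - 2" 1] by simp
    then show "ennreal (r * t powr (r - 2)) * (ennreal t * indicator {v. ennreal t < v} u) * indicator {0<..} t
       = ennreal (r * t powr (r - 1)) * indicator {t. 0 < t \<and> ennreal t < u} t"
      using r by (auto simp: indicator_def ennreal_mult[symmetric])
  qed
  then show ?thesis using layer_cake[OF r] by simp
qed

text \<open>The levels t \<ge> u carry the weight t^(r-2), whose tail converges exactly for r < 1.
  This is the restriction that singles out small exponents in the change of aperture.\<close>

lemma nn_integral_above_level:
  assumes r: "0 < r" "r < 1"
  shows "(\<integral>\<^sup>+t\<in>{0<..}. ennreal (r * t powr (r - 2)) * (u * indicator {v. v \<le> ennreal t} u) \<partial>lborel)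
    \<le> ennreal (r / (1 - r)) * epow u r"
proof (cases u)
  case top
  then show ?thesis using r by (simp add: ennreal_mult_top ennreal_eq_0_iff not_le)
next
  case (real v)
  show ?thesis
  proof (cases "v = 0")
    case True
    then show ?thesis using real by simp
  next
    case False
    then have v: "0 < v" using real by simp
    have "((\<lambda>t. r * v * t powr (r - 2)) has_integral (r * v * (- (v powr (r - 2 + 1)) / (r - 2 + 1)))) {v..}"
      using r v by (intro has_integral_mult_right has_integral_powr_to_inf) auto
    then have "((\<lambda>t. r * v * t powr (r - 2)) has_integral (r / (1 - r) * v powr r)) {v..}"
    proof (rule has_integral_eq_rhs)
      have "v powr r = v powr (r - 1) * v" using v powr_add[of v "r - 1" 1] by simp
      then show "r / (1 - r) * v powr r = r * v * (- (v powr (r - 2 + 1)) / (r - 2 + 1))"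
        using r by (simp add: field_simps)
    qed
    then have "(\<integral>\<^sup>+t\<in>{v..}. ennreal (r * v * t powr (r - 2)) \<partial>lborel) = ennreal (r / (1 - r) * v powr r)"
      using r v by (intro nn_integral_has_integral_lebesgue') auto
    moreover have "(\<integral>\<^sup>+t\<in>{0<..}. ennreal (r * t powr (r - 2)) * (u * indicator {v. v \<le> ennreal t} u) \<partial>lborel)
       = (\<integral>\<^sup>+t\<in>{v..}. ennreal (r * v * t powr (r - 2)) \<partial>lborel)"
      using r v real
      by (intro nn_integral_cong) (auto simp: indicator_def ennreal_mult[symmetric] ennreal_le_iff2 mult_ac)
    ultimately show ?thesis
      using r real by (simp add: epow_ennreal ennreal_mult[symmetric])
  qed
qed

lemma epow_mult_self: "u * epow u r = epow u (r + 1)"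
proof (cases u)
  case (real v)
  then show ?thesis
    by (cases "v = 0") (simp_all add: epow_ennreal ennreal_mult[symmetric] powr_add mult.commute)
qed simp

text \<open>Here t^(r-2) is integrated near 0, hence r > 1. The range t < 2u comes from cutting a
  function at half the level in the proof of the strong maximal inequality.\<close>

lemma nn_integral_below_double_level:
  assumes r: "1 < r"
  shows "(\<integral>\<^sup>+t\<in>{0<..}. ennreal (r * t powr (r - 2)) * (u * indicator {v. ennreal t < 2 * v} u) \<partial>lborel)
    = ennreal (r / (r - 1) * 2 powr (r - 1)) * epow u r"
proof -
  have "(\<integral>\<^sup>+t\<in>{0<..}. ennreal (r * t powr (r - 2)) * (u * indicator {v. ennreal t < 2 * v} u) \<partial>lborel)
     = (\<integral>\<^sup>+t. (ennreal (r / (r - 1)) * u) * (ennreal ((r - 1) * t powr (r - 1 - 1)) * indicator {t. 0 < t \<and> ennreal t < 2 * u} t) \<partial>lborel)"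
  proof (rule nn_integral_cong)
    fix t :: real
    have "ennreal (r * t powr (r - 2)) = ennreal (r / (r - 1)) * ennreal ((r - 1) * t powr (r - 1 - 1))"
      using r by (subst ennreal_mult[symmetric]) auto
    then show "ennreal (r * t powr (r - 2)) * (u * indicator {v. ennreal t < 2 * v} u) * indicator {0<..} t
      = ennreal (r / (r - 1)) * u * (ennreal ((r - 1) * t powr (r - 1 - 1)) * indicator {t. 0 < t \<and> ennreal t < 2 * u} t)"
      by (simp only: mult_ac) (simp add: indicator_def)
  qed
  also have "\<dots> = ennreal (r / (r - 1)) * u * epow (2 * u) (r - 1)"
    using r layer_cake[of "r - 1" "2 * u"] by (subst nn_integral_cmult) simp_all
  also have "\<dots> = ennreal (r / (r - 1)) * ennreal (2 powr (r - 1)) * (u * epow u (r - 1))"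
    using epow_ennreal[of 2 "r - 1"] by (simp add: epow_mult mult_ac)
  also have "u * epow u (r - 1) = epow u r"
    using epow_mult_self[of u "r - 1"] r by simp
  finally show ?thesis using r by (simp add: ennreal_mult[symmetric])
qed

section \<open>The maximal function\<close>

lemma borel_measurable_fst_snd [measurable (raw)]:
  fixes f :: "_ \<Rightarrow> 'a::euclidean_space \<times> 'b::euclidean_space"
  assumes f: "f \<in> borel_measurable M"
  shows "(\<lambda>x. fst (f x)) \<in> borel_measurable M" "(\<lambda>x. snd (f x)) \<in> borel_measurable M"
  by (rule measurable_compose[OF f], rule borel_measurable_continuous_onI, intro continuous_intros)+

lemma measurable_pred_in_ball [measurable (raw)]:
  fixes f g :: "_ \<Rightarrow> 'a::euclidean_space"
  assumes [measurable]: "f \<in> borel_measurable M" "g \<in> borel_measurable M" "k \<in> borel_measurable M"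
  shows "Measurable.pred M (\<lambda>x. f x \<in> ball (g x) (k x))"
  unfolding mem_ball by measurable

definition maximal_fn :: "('a::euclidean_space \<Rightarrow> ennreal) \<Rightarrow> 'a \<Rightarrow> ennreal" where
  "maximal_fn h x = (SUP (c, \<rho>) \<in> {(c, \<rho>). 0 < \<rho> \<and> x \<in> ball c \<rho>}.
     (\<integral>\<^sup>+z\<in>ball c \<rho>. h z \<partial>lborel) / emeasure lborel (ball c \<rho>))"

lemma emeasure_ball_pos_finite:
  fixes c :: "'a::euclidean_space"
  assumes "0 < \<rho>"
  shows "emeasure lborel (ball c \<rho>) \<noteq> 0" "emeasure lborel (ball c \<rho>) < top"
  using assms by (auto simp: emeasure_ball ennreal_eq_0_iff not_le)

lemma less_divide_ennreal_iff: "b \<noteq> 0 \<Longrightarrow> b < top \<Longrightarrow> l < a / b \<longleftrightarrow> l * b < (a::ennreal)"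
proof -
  assume b: "b \<noteq> 0" "b < top"
  have "a / b \<le> l" if "a \<le> l * b"
    using divide_right_mono_ennreal[OF that, of b] b by (simp add: ennreal_mult_divide_eq)
  moreover have "a \<le> l * b" if "a / b \<le> l"
    using mult_right_mono[OF that, of b] b by (simp add: ennreal_divide_times)
  ultimately show "l < a / b \<longleftrightarrow> l * b < a"
    by (auto simp: not_le[symmetric])
qed

lemma level_set_maximal_fn: "{x. l < maximal_fn h x} = max_set h l"
proof -
  have "l < maximal_fn h x \<longleftrightarrow> x \<in> max_set h l" for x
  proof -
    have "l < maximal_fn h x \<longleftrightarrow> (\<exists>c \<rho>. 0 < \<rho> \<and> x \<in> ball c \<rho> \<and>
        l < (\<integral>\<^sup>+z\<in>ball c \<rho>. h z \<partial>lborel) / emeasure lborel (ball c \<rho>))"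
      unfolding maximal_fn_def less_SUP_iff by auto
    also have "\<dots> \<longleftrightarrow> (\<exists>c \<rho>. 0 < \<rho> \<and> x \<in> ball c \<rho> \<and>
        l * emeasure lborel (ball c \<rho>) < (\<integral>\<^sup>+z\<in>ball c \<rho>. h z \<partial>lborel))"
      by (intro ex_cong1 conj_cong refl less_divide_ennreal_iff emeasure_ball_pos_finite)
    also have "\<dots> \<longleftrightarrow> x \<in> max_set h l"
      by (simp only: mem_max_set)
    finally show ?thesis .
  qed
  then show ?thesis by auto
qed

lemma measurable_maximal_fn [measurable]: "maximal_fn h \<in> borel_measurable borel"
  by (rule borel_measurableI_greater) (simp add: level_set_maximal_fn)

text \<open>The part of h below t/2 adds at most t/2 to any average, so an average above t leaves
  more than t/2 to the part above t/2. This is the truncation of Marcinkiewicz interpolation between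
  weak (1,1) and the trivial bound at infinity.\<close>

lemma max_set_subset_truncated:
  fixes h :: "'a::euclidean_space \<Rightarrow> ennreal"
  assumes [measurable]: "h \<in> borel_measurable borel" and t: "0 < t"
  shows "max_set h (ennreal t) \<subseteq> max_set (\<lambda>x. h x * indicator {v. ennreal t < 2 * v} (h x)) (ennreal (t / 2))"
proof
  fix x assume "x \<in> max_set h (ennreal t)"
  then obtain c \<rho> where c: "0 < \<rho>" "x \<in> ball c \<rho>"
    and lt: "ennreal t * emeasure lborel (ball c \<rho>) < (\<integral>\<^sup>+x\<in>ball c \<rho>. h x \<partial>lborel)"
    unfolding max_set_def by auto
  let ?h = "\<lambda>x. h x * indicator {v. ennreal t < 2 * v} (h x)"
  have half: "h y \<le> ?h y + ennreal (t / 2)" for y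
  proof (cases "ennreal t < 2 * h y")
    case False
    then have "2 * h y \<le> 2 * ennreal (t / 2)"
      using t by (simp add: ennreal_mult[symmetric] flip: ennreal_numeral)
    then have "h y \<le> ennreal (t / 2)"
      by (subst (asm) ennreal_mult_le_mult_iff) auto
    then show ?thesis by (simp add: add_increasing)
  qed simp
  have "(\<integral>\<^sup>+x\<in>ball c \<rho>. h x \<partial>lborel)
      \<le> (\<integral>\<^sup>+x. ?h x * indicator (ball c \<rho>) x + ennreal (t / 2) * indicator (ball c \<rho>) x \<partial>lborel)"
    using half by (intro nn_integral_mono) (auto simp: indicator_def)
  also have "\<dots> = (\<integral>\<^sup>+x\<in>ball c \<rho>. ?h x \<partial>lborel) + ennreal (t / 2) * emeasure lborel (ball c \<rho>)"
    by (subst nn_integral_add, measurable) (subst nn_integral_cmult_indicator, simp_all)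
  finally have "ennreal (t / 2) * emeasure lborel (ball c \<rho>) + ennreal (t / 2) * emeasure lborel (ball c \<rho>)
     < (\<integral>\<^sup>+x\<in>ball c \<rho>. ?h x \<partial>lborel) + ennreal (t / 2) * emeasure lborel (ball c \<rho>)"
    using lt t by (simp flip: distrib_right ennreal_plus)
  then have "ennreal (t / 2) * emeasure lborel (ball c \<rho>) < (\<integral>\<^sup>+x\<in>ball c \<rho>. ?h x \<partial>lborel)"
    by (meson add_right_mono leD leI)
  with c show "x \<in> max_set ?h (ennreal (t / 2))"
    unfolding max_set_def by blast
qed

text \<open>The weak-type bound is applied at level t/2 to the truncation that depends on t; hence 2
  * 5^n, and the last factor is the integral over levels t < 2u.\<close>

lemma strong_type_maximal:
  fixes h :: "'a::euclidean_space \<Rightarrow> ennreal"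
  assumes [measurable]: "h \<in> borel_measurable borel" and r: "1 < r"
  shows "(\<integral>\<^sup>+x. epow (maximal_fn h x) r \<partial>lborel)
    \<le> ennreal (2 * 5 ^ DIM('a) * (r / (r - 1) * 2 powr (r - 1))) * (\<integral>\<^sup>+x. epow (h x) r \<partial>lborel)"
proof (rule nn_integral_epow_le_of_distribution[where
      \<Phi> = "\<lambda>t u. ennreal (2 * 5 ^ DIM('a)) * (u * indicator {v. ennreal t < 2 * v} u)"])
  fix t :: real assume t: "0 < t"
  let ?h = "\<lambda>x. h x * indicator {v. ennreal t < 2 * v} (h x)"
  have "ennreal t * emeasure lborel {x. ennreal t < maximal_fn h x}
      \<le> ennreal t * emeasure lborel (max_set ?h (ennreal (t / 2)))"
    unfolding level_set_maximal_fn
    using max_set_subset_truncated[of h t] t by (intro mult_left_mono emeasure_mono) auto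
  also have "\<dots> = 2 * (ennreal (t / 2) * emeasure lborel (max_set ?h (ennreal (t / 2))))"
    using t by (simp add: ennreal_mult'[symmetric] mult.assoc[symmetric] flip: ennreal_numeral)
  also have "\<dots> \<le> 2 * (ennreal (5 ^ DIM('a)) * (\<integral>\<^sup>+x. ?h x \<partial>lborel))"
    using t by (intro mult_left_mono weak_type_maximal) auto
  also have "\<dots> = (\<integral>\<^sup>+x. ennreal (2 * 5 ^ DIM('a)) * ?h x \<partial>lborel)"
    by (subst nn_integral_cmult) (auto simp: ennreal_mult mult.assoc)
  finally show "ennreal t * emeasure lborel {x. ennreal t < maximal_fn h x}
      \<le> (\<integral>\<^sup>+x. ennreal (2 * 5 ^ DIM('a)) * ?h x \<partial>lborel)" .
next
  fix u :: ennreal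
  have "(\<integral>\<^sup>+t\<in>{0<..}. ennreal (r * t powr (r - 2)) *
        (ennreal (2 * 5 ^ DIM('a)) * (u * indicator {v. ennreal t < 2 * v} u)) \<partial>lborel)
      = (\<integral>\<^sup>+t. ennreal (2 * 5 ^ DIM('a)) * (ennreal (r * t powr (r - 2)) *
         (u * indicator {v. ennreal t < 2 * v} u) * indicator {0<..} t) \<partial>lborel)"
    by (simp add: mult_ac)
  also have "\<dots> = ennreal (2 * 5 ^ DIM('a)) * (ennreal (r / (r - 1) * 2 powr (r - 1)) * epow u r)"
    using r by (subst nn_integral_cmult) (auto simp: nn_integral_below_double_level)
  also have "\<dots> = ennreal (2 * 5 ^ DIM('a) * (r / (r - 1) * 2 powr (r - 1))) * epow u r"
    using r by (simp add: ennreal_mult[symmetric] mult.assoc[symmetric])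
  finally show "(\<integral>\<^sup>+t\<in>{0<..}. ennreal (r * t powr (r - 2)) *
        (ennreal (2 * 5 ^ DIM('a)) * (u * indicator {v. ennreal t < 2 * v} u)) \<partial>lborel)
      \<le> ennreal (2 * 5 ^ DIM('a) * (r / (r - 1) * 2 powr (r - 1))) * epow u r"
    by simp
qed (measurable, use r in simp)

text \<open>The area functional before its outer root: the density, including the factor t^(-n-1),
  is left to g so that only the cone changes with a. For a > 0 the condition forces s > 0.\<close>

definition aperture_int :: "real \<Rightarrow> ('a::euclidean_space \<times> real \<Rightarrow> ennreal) \<Rightarrow> 'a \<Rightarrow> ennreal" where
  "aperture_int a g x = (\<integral>\<^sup>+w\<in>{(y, s). dist y x < a * s}. g w \<partial>lborel)"

lemma measurable_aperture_int [measurable]: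
  assumes [measurable]: "g \<in> borel_measurable borel"
  shows "aperture_int a g \<in> borel_measurable borel"
  unfolding aperture_int_def case_prod_beta by measurable

text \<open>A point (y, s) lies in the cone at x exactly when x lies in the ball about y of radius a
  s. Comparing two apertures thus reduces to comparing integrals over two concentric balls, for each
  (y, s) separately.\<close>

lemma nn_integral_mult_aperture_int:
  assumes [measurable]: "g \<in> borel_measurable borel" "h \<in> borel_measurable borel"
  shows "(\<integral>\<^sup>+x. h x * aperture_int a g x \<partial>lborel)
     = (\<integral>\<^sup>+w. g w * (\<integral>\<^sup>+x\<in>ball (fst w) (a * snd w). h x \<partial>lborel) \<partial>lborel)"
proof -
  have "(\<integral>\<^sup>+x. h x * aperture_int a g x \<partial>lborel)
     = (\<integral>\<^sup>+x. (\<integral>\<^sup>+w. h x * (g w * indicator {w. dist (fst w) x < a * snd w} w) \<partial>lborel) \<partial>lborel)"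
    unfolding aperture_int_def case_prod_beta by (subst nn_integral_cmult) auto
  also have "\<dots> = (\<integral>\<^sup>+w. (\<integral>\<^sup>+x. h x * (g w * indicator {w. dist (fst w) x < a * snd w} w) \<partial>lborel) \<partial>lborel)"
    by (rule lborel_pair.Fubini') measurable
  also have "\<dots> = (\<integral>\<^sup>+w. (\<integral>\<^sup>+x. g w * (h x * indicator (ball (fst w) (a * snd w)) x) \<partial>lborel) \<partial>lborel)"
    by (intro nn_integral_cong) (auto simp: indicator_def mult_ac)
  also have "\<dots> = (\<integral>\<^sup>+w. g w * (\<integral>\<^sup>+x\<in>ball (fst w) (a * snd w). h x \<partial>lborel) \<partial>lborel)"
    by (intro nn_integral_cong nn_integral_cmult) auto
  finally show ?thesis .
qed

section \<open>Change of aperture\<close>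

lemma emeasure_max_set_indicator:
  fixes U :: "'a::euclidean_space set"
  assumes [measurable]: "U \<in> sets borel" and k: "0 < k"
  shows "emeasure lborel (max_set (indicator U) (ennreal (1 / k))) \<le> ennreal (k * 5 ^ DIM('a)) * emeasure lborel U"
proof -
  have "emeasure lborel (max_set (indicator U) (ennreal (1 / k)))
      = ennreal k * (ennreal (1 / k) * emeasure lborel (max_set (indicator U) (ennreal (1 / k))))"
    using k by (simp add: mult.assoc[symmetric] ennreal_mult[symmetric])
  also have "\<dots> \<le> ennreal k * (ennreal (5 ^ DIM('a)) * (\<integral>\<^sup>+x. indicator U x \<partial>lborel))"
    using k by (intro mult_left_mono weak_type_maximal) auto
  also have "\<dots> = ennreal (k * 5 ^ DIM('a)) * emeasure lborel U"
    using k by (simp add: ennreal_mult mult.assoc)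
  finally show ?thesis .
qed

text \<open>The threshold is calibrated by volumes. A point of the large ball outside the maximal
  set says that U fills at most the fraction 1/k of it; since the large ball has a^n times the
  measure of the small one, k = 2 a^n makes this at most half of the small ball. The other half lies
  off U, and k times that half is the whole large ball.\<close>

lemma nn_integral_aperture_int_off_max_set:
  fixes g :: "'a::euclidean_space \<times> real \<Rightarrow> ennreal"
  assumes [measurable]: "g \<in> borel_measurable borel" "U \<in> sets borel" and a: "1 \<le> a"
  defines "k \<equiv> 2 * a ^ DIM('a)"
  shows "(\<integral>\<^sup>+x\<in>- max_set (indicator U) (ennreal (1 / k)). aperture_int a g x \<partial>lborel)
      \<le> ennreal k * (\<integral>\<^sup>+x\<in>- U. aperture_int 1 g x \<partial>lborel)"
proof -
  define V where "V = max_set (indicator U :: 'a \<Rightarrow> ennreal) (ennreal (1 / k))"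
  have [measurable]: "V \<in> sets borel" by (simp add: V_def)
  have k: "0 < k" using a by (simp add: k_def)
  have ball: "(\<integral>\<^sup>+x\<in>ball y (a * s). indicator (- V) x \<partial>lborel)
      \<le> ennreal k * (\<integral>\<^sup>+x\<in>ball y (1 * s). indicator (- U) x \<partial>lborel)" for y :: 'a and s :: real
  \<comment> \<open>In the excluded case the large ball is empty or contained in V, and the left
    integrand vanishes.\<close>
  proof (cases "0 < s \<and> \<not> ball y (a * s) \<subseteq> V")
    case False
    then have "indicator (- V) x * indicator (ball y (a * s)) x = (0 :: ennreal)" for x
    proof (cases "0 < s")
      case True
      with False show ?thesis by (auto simp: indicator_def)
    next
      case False
      then have "a * s \<le> 0" using a by (simp add: mult_le_0_iff)
      then have "ball y (a * s) = {}" by simp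
      then have "x \<notin> ball y (a * s)" by blast
      then show ?thesis by (simp del: mem_ball)
    qed
    then show ?thesis by (simp only: nn_integral_const mult_zero_left zero_le)
  next
    case True
    then obtain x where x: "x \<in> ball y (a * s)" "x \<notin> V" and s: "0 < s" by blast
    have as: "0 < a * s" using a s by simp
    define b where "b = unit_ball_vol (real DIM('a)) * s ^ DIM('a)"
    have b: "0 < b" "emeasure lborel (ball y s) = ennreal b"
      using s by (auto simp: b_def emeasure_ball)
    have b': "emeasure lborel (ball y (a * s)) = ennreal (a ^ DIM('a) * b)"
      using a s by (simp add: b_def emeasure_ball power_mult_distrib mult_ac)
    have sub: "ball y s \<subseteq> ball y (a * s)"
      using a s by (intro subset_ball) simp
    have "\<not> ennreal (1 / k) * emeasure lborel (ball y (a * s)) < (\<integral>\<^sup>+x\<in>ball y (a * s). indicator U x \<partial>lborel)"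
      using x as unfolding V_def mem_max_set by blast
    then have "(\<integral>\<^sup>+x\<in>ball y (a * s). indicator U x \<partial>lborel) \<le> ennreal (1 / k) * ennreal (a ^ DIM('a) * b)"
      by (simp add: b')
    also have "\<dots> = ennreal (b / 2)"
      using a b by (simp add: k_def ennreal_mult[symmetric])
    finally have "(\<integral>\<^sup>+x\<in>ball y (a * s). indicator U x \<partial>lborel) \<le> ennreal (b / 2)" .
    moreover have "(\<integral>\<^sup>+x\<in>ball y s. indicator U x \<partial>lborel) \<le> (\<integral>\<^sup>+x\<in>ball y (a * s). indicator U x \<partial>lborel)"
      using sub by (intro nn_integral_mono) (auto simp: indicator_def)
    ultimately have U: "(\<integral>\<^sup>+x\<in>ball y s. indicator U x \<partial>lborel) \<le> ennreal (b / 2)" by simp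
    have "ennreal b = (\<integral>\<^sup>+x. indicator U x * indicator (ball y s) x + indicator (- U) x * indicator (ball y s) x \<partial>lborel)"
      unfolding b(2)[symmetric]
      by (subst nn_integral_indicator[symmetric], simp, intro nn_integral_cong) (auto simp: indicator_def)
    also have "\<dots> = (\<integral>\<^sup>+x\<in>ball y s. indicator U x \<partial>lborel) + (\<integral>\<^sup>+x\<in>ball y s. indicator (- U) x \<partial>lborel)"
      by (rule nn_integral_add) measurable
    finally have *: "ennreal b \<le> ennreal (b / 2) + (\<integral>\<^sup>+x\<in>ball y s. indicator (- U) x \<partial>lborel)"
      using U by (metis add_right_mono)
    have "ennreal (b / 2) \<le> (\<integral>\<^sup>+x\<in>ball y s. indicator (- U) x \<partial>lborel)"
    proof (cases "\<integral>\<^sup>+x\<in>ball y s. indicator (- U) x \<partial>lborel")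
      case (real c)
      with * b show ?thesis by (simp add: ennreal_plus[symmetric] ennreal_le_iff del: ennreal_plus)
    qed simp
    then have "ennreal k * ennreal (b / 2) \<le> ennreal k * (\<integral>\<^sup>+x\<in>ball y (1 * s). indicator (- U) x \<partial>lborel)"
      by (intro mult_left_mono) auto
    moreover have "(\<integral>\<^sup>+x\<in>ball y (a * s). indicator (- V) x \<partial>lborel) \<le> (\<integral>\<^sup>+x. indicator (ball y (a * s)) x \<partial>lborel)"
      by (intro nn_integral_mono) (auto simp: indicator_def)
    moreover have "(\<integral>\<^sup>+x. indicator (ball y (a * s)) x \<partial>lborel) = ennreal k * ennreal (b / 2)"
    proof -
      have "k * (b / 2) = a ^ DIM('a) * b" by (simp add: k_def)
      then have "ennreal k * ennreal (b / 2) = ennreal (a ^ DIM('a) * b)"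
        using k b by (simp only: ennreal_mult[symmetric] less_imp_le half_gt_zero)
      then show ?thesis by (simp del: mem_ball add: b')
    qed
    ultimately show ?thesis by (simp only:)
  qed
  have "(\<integral>\<^sup>+x\<in>- V. aperture_int a g x \<partial>lborel)
      = (\<integral>\<^sup>+w. g w * (\<integral>\<^sup>+x\<in>ball (fst w) (a * snd w). indicator (- V) x \<partial>lborel) \<partial>lborel)"
    by (subst nn_integral_mult_aperture_int[symmetric]) (simp_all add: mult.commute)
  also have "\<dots> \<le> (\<integral>\<^sup>+w. ennreal k * (g w * (\<integral>\<^sup>+x\<in>ball (fst w) (1 * snd w). indicator (- U) x \<partial>lborel)) \<partial>lborel)"
    by (intro nn_integral_mono, subst mult.left_commute, intro mult_left_mono ball zero_le)
  also have "\<dots> = ennreal k * (\<integral>\<^sup>+w. g w * (\<integral>\<^sup>+x\<in>ball (fst w) (1 * snd w). indicator (- U) x \<partial>lborel) \<partial>lborel)"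
    by (rule nn_integral_cmult) measurable
  also have "\<dots> = ennreal k * (\<integral>\<^sup>+x\<in>- U. aperture_int 1 g x \<partial>lborel)"
    by (subst nn_integral_mult_aperture_int[symmetric]) (simp_all add: mult.commute)
  finally show ?thesis unfolding V_def .
qed

text \<open>With U the level set at aperture 1, the maximal set V of its indicator is measured by
  the weak-type bound. Off V, Chebyshev's inequality and the comparison of integrals yield the
  second term.\<close>

lemma aperture_int_distribution:
  fixes g :: "'a::euclidean_space \<times> real \<Rightarrow> ennreal"
  assumes [measurable]: "g \<in> borel_measurable borel" and a: "1 \<le> a"
  defines "k \<equiv> 2 * a ^ DIM('a)"
  shows "ennreal t * emeasure lborel {x. ennreal t < aperture_int a g x}
    \<le> ennreal (k * 5 ^ DIM('a)) * (ennreal t * emeasure lborel {x. ennreal t < aperture_int 1 g x})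
      + ennreal k * (\<integral>\<^sup>+x\<in>{x. aperture_int 1 g x \<le> ennreal t}. aperture_int 1 g x \<partial>lborel)"
proof -
  define U where "U = {x. ennreal t < aperture_int 1 g x}"
  define V where "V = max_set (indicator U :: 'a \<Rightarrow> ennreal) (ennreal (1 / k))"
  have [measurable]: "V \<in> sets borel" by (simp add: V_def)
  have U [measurable]: "U \<in> sets borel" unfolding U_def by measurable
  have k: "0 < k" using a by (simp add: k_def)
  let ?L = "{x. ennreal t < aperture_int a g x}"
  have "emeasure lborel ?L \<le> emeasure lborel (V \<union> (- V \<inter> ?L))"
    by (intro emeasure_mono) auto
  also have "\<dots> \<le> emeasure lborel V + emeasure lborel (- V \<inter> ?L)"
    by (intro emeasure_subadditive) auto
  finally have "ennreal t * emeasure lborel ?L \<le> ennreal t * (emeasure lborel V + emeasure lborel (- V \<inter> ?L))"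
    by (rule mult_left_mono) simp
  also have "\<dots> = ennreal t * emeasure lborel V + ennreal t * emeasure lborel (- V \<inter> ?L)"
    by (simp add: distrib_left)
  also have "ennreal t * emeasure lborel (- V \<inter> ?L) = (\<integral>\<^sup>+x. ennreal t * indicator (- V \<inter> ?L) x \<partial>lborel)"
    by (simp add: nn_integral_cmult)
  also have "\<dots> \<le> (\<integral>\<^sup>+x\<in>- V. aperture_int a g x \<partial>lborel)"
    by (intro nn_integral_mono) (auto simp: indicator_def)
  also have "\<dots> \<le> ennreal k * (\<integral>\<^sup>+x\<in>- U. aperture_int 1 g x \<partial>lborel)"
    unfolding V_def k_def using a by (intro nn_integral_aperture_int_off_max_set) auto
  also have "- U = {x. aperture_int 1 g x \<le> ennreal t}"
    by (auto simp: U_def)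
  also have "ennreal t * emeasure lborel V \<le> ennreal t * (ennreal (k * 5 ^ DIM('a)) * emeasure lborel U)"
    unfolding V_def using k by (intro mult_left_mono emeasure_max_set_indicator) auto
  also have "\<dots> = ennreal (k * 5 ^ DIM('a)) * (ennreal t * emeasure lborel U)"
    by (simp only: mult_ac)
  finally show ?thesis
    unfolding U_def by (simp add: add_right_mono)
qed

text \<open>The limiting case of level 0: off U the narrow integral is zero, so the wide one
  vanishes almost everywhere off V. Applied to indicators of {F > l}, it compares the level sets of
  nontangential maximal functions.\<close>

lemma aperture_int_support:
  fixes g :: "'a::euclidean_space \<times> real \<Rightarrow> ennreal"
  assumes [measurable]: "g \<in> borel_measurable borel" and a: "1 \<le> a"
  shows "emeasure lborel {x. 0 < aperture_int a g x}
    \<le> ennreal (2 * a ^ DIM('a) * 5 ^ DIM('a)) * emeasure lborel {x. 0 < aperture_int 1 g x}"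
proof -
  let ?k = "2 * a ^ DIM('a)"
  define U where "U = {x. 0 < aperture_int 1 g x}"
  define V where "V = max_set (indicator U :: 'a \<Rightarrow> ennreal) (ennreal (1 / ?k))"
  have [measurable]: "V \<in> sets borel" by (simp add: V_def)
  have [measurable]: "U \<in> sets borel" unfolding U_def by measurable
  have "(\<integral>\<^sup>+x\<in>- V. aperture_int a g x \<partial>lborel) \<le> ennreal ?k * (\<integral>\<^sup>+x\<in>- U. aperture_int 1 g x \<partial>lborel)"
    unfolding V_def using a by (intro nn_integral_aperture_int_off_max_set) auto
  also have "(\<integral>\<^sup>+x\<in>- U. aperture_int 1 g x \<partial>lborel) = (\<integral>\<^sup>+x. 0 \<partial>(lborel :: 'a measure))"
    by (intro nn_integral_cong) (auto simp: U_def indicator_def)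
  finally have "AE x in lborel. aperture_int a g x * indicator (- V) x = 0"
    by (simp add: nn_integral_0_iff_AE)
  then have "AE x in lborel. x \<in> {x. 0 < aperture_int a g x} \<longrightarrow> x \<in> V"
    by eventually_elim (auto simp: indicator_def split: if_splits)
  then have "emeasure lborel {x. 0 < aperture_int a g x} \<le> emeasure lborel V"
    by (rule emeasure_mono_AE) simp
  also have "\<dots> \<le> ennreal (?k * 5 ^ DIM('a)) * emeasure lborel U"
    unfolding V_def using a by (intro emeasure_max_set_indicator) auto
  finally show ?thesis unfolding U_def .
qed

text \<open>The two summands of the constant match the two terms of the distribution bound: the
  first is integrated over levels below the value of the narrow functional, the second over levels
  above it.\<close>

lemma nn_integral_epow_aperture_int_small:
  fixes g :: "'a::euclidean_space \<times> real \<Rightarrow> ennreal"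
  assumes [measurable]: "g \<in> borel_measurable borel" and a: "1 \<le> a" and r: "0 < r" "r < 1"
  defines "k \<equiv> 2 * a ^ DIM('a)"
  shows "(\<integral>\<^sup>+x. epow (aperture_int a g x) r \<partial>lborel)
    \<le> ennreal (k * 5 ^ DIM('a) + k * (r / (1 - r))) * (\<integral>\<^sup>+x. epow (aperture_int 1 g x) r \<partial>lborel)"
proof (rule nn_integral_epow_le_of_distribution[where
      \<Phi> = "\<lambda>t u. ennreal (k * 5 ^ DIM('a)) * (ennreal t * indicator {v. ennreal t < v} u)
             + ennreal k * (u * indicator {v. v \<le> ennreal t} u)"])
  have k: "0 < k" using a by (simp add: k_def)
  fix t :: real
  let ?A = "aperture_int 1 g" and ?S = "{x. ennreal t < aperture_int 1 g x}"
  have "(\<integral>\<^sup>+x. ennreal (k * 5 ^ DIM('a)) * (ennreal t * indicator {v. ennreal t < v} (?A x))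
             + ennreal k * (?A x * indicator {v. v \<le> ennreal t} (?A x)) \<partial>lborel)
     = (\<integral>\<^sup>+x. ennreal (k * 5 ^ DIM('a)) * (ennreal t * indicator ?S x)
             + ennreal k * (?A x * indicator {x. ?A x \<le> ennreal t} x) \<partial>lborel)"
    by (simp add: indicator_def)
  also have "\<dots> = (\<integral>\<^sup>+x. ennreal (k * 5 ^ DIM('a)) * (ennreal t * indicator ?S x) \<partial>lborel)
      + (\<integral>\<^sup>+x. ennreal k * (?A x * indicator {x. ?A x \<le> ennreal t} x) \<partial>lborel)"
    by (rule nn_integral_add) measurable
  also have "(\<integral>\<^sup>+x. ennreal (k * 5 ^ DIM('a)) * (ennreal t * indicator ?S x) \<partial>lborel)
      = ennreal (k * 5 ^ DIM('a)) * (ennreal t * emeasure lborel ?S)"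
    by (simp add: nn_integral_cmult)
  also have "(\<integral>\<^sup>+x. ennreal k * (?A x * indicator {x. ?A x \<le> ennreal t} x) \<partial>lborel)
      = ennreal k * (\<integral>\<^sup>+x\<in>{x. ?A x \<le> ennreal t}. ?A x \<partial>lborel)"
    by (rule nn_integral_cmult) measurable
  finally have "(\<integral>\<^sup>+x. ennreal (k * 5 ^ DIM('a)) * (ennreal t * indicator {v. ennreal t < v} (?A x))
             + ennreal k * (?A x * indicator {v. v \<le> ennreal t} (?A x)) \<partial>lborel)
     = ennreal (k * 5 ^ DIM('a)) * (ennreal t * emeasure lborel ?S)
      + ennreal k * (\<integral>\<^sup>+x\<in>{x. ?A x \<le> ennreal t}. ?A x \<partial>lborel)" .
  then show "ennreal t * emeasure lborel {x. ennreal t < aperture_int a g x}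
    \<le> (\<integral>\<^sup>+x. ennreal (k * 5 ^ DIM('a)) * (ennreal t * indicator {v. ennreal t < v} (aperture_int 1 g x))
             + ennreal k * (aperture_int 1 g x * indicator {v. v \<le> ennreal t} (aperture_int 1 g x)) \<partial>lborel)"
    using aperture_int_distribution[of g a t] a by (simp add: k_def)
next
  have k: "0 < k" using a by (simp add: k_def)
  fix u :: ennreal
  let ?f = "\<lambda>t. ennreal (r * t powr (r - 2)) * (ennreal t * indicator {v. ennreal t < v} u) * indicator {0<..} t"
  let ?g = "\<lambda>t. ennreal (r * t powr (r - 2)) * (u * indicator {v. v \<le> ennreal t} u) * indicator {0<..} t"
  have "(\<integral>\<^sup>+t\<in>{0<..}. ennreal (r * t powr (r - 2)) *
        (ennreal (k * 5 ^ DIM('a)) * (ennreal t * indicator {v. ennreal t < v} u)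
          + ennreal k * (u * indicator {v. v \<le> ennreal t} u)) \<partial>lborel)
     = (\<integral>\<^sup>+t. ennreal (k * 5 ^ DIM('a)) * ?f t + ennreal k * ?g t \<partial>lborel)"
    by (simp only: distrib_left distrib_right mult_ac)
  also have "\<dots> = (\<integral>\<^sup>+t. ennreal (k * 5 ^ DIM('a)) * ?f t \<partial>lborel) + (\<integral>\<^sup>+t. ennreal k * ?g t \<partial>lborel)"
    by (rule nn_integral_add) measurable
  also have "(\<integral>\<^sup>+t. ennreal (k * 5 ^ DIM('a)) * ?f t \<partial>lborel) = ennreal (k * 5 ^ DIM('a)) * (\<integral>\<^sup>+t. ?f t \<partial>lborel)"
    by (rule nn_integral_cmult) measurable
  also have "(\<integral>\<^sup>+t. ?f t \<partial>lborel) = epow u r"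
    by (rule nn_integral_below_level[OF r(1)])
  also have "(\<integral>\<^sup>+t. ennreal k * ?g t \<partial>lborel) = ennreal k * (\<integral>\<^sup>+t. ?g t \<partial>lborel)"
    by (rule nn_integral_cmult) measurable
  also have "ennreal (k * 5 ^ DIM('a)) * epow u r + ennreal k * (\<integral>\<^sup>+t. ?g t \<partial>lborel)
      \<le> ennreal (k * 5 ^ DIM('a)) * epow u r + ennreal k * (ennreal (r / (1 - r)) * epow u r)"
    using r by (intro add_left_mono mult_left_mono nn_integral_above_level) auto
  also have "\<dots> = ennreal (k * 5 ^ DIM('a) + k * (r / (1 - r))) * epow u r"
    using r k by (simp add: ennreal_plus ennreal_mult distrib_right mult.assoc
        del: times_divide_eq_right times_divide_eq_left)
  finally show "(\<integral>\<^sup>+t\<in>{0<..}. ennreal (r * t powr (r - 2)) *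
        (ennreal (k * 5 ^ DIM('a)) * (ennreal t * indicator {v. ennreal t < v} u)
          + ennreal k * (u * indicator {v. v \<le> ennreal t} u)) \<partial>lborel)
     \<le> ennreal (k * 5 ^ DIM('a) + k * (r / (1 - r))) * epow u r" .
qed (measurable, use r in simp)

text \<open>Testing against h = 1 leaves only ball volumes, and these scale by a^n.\<close>

lemma nn_integral_aperture_int:
  fixes g :: "'a::euclidean_space \<times> real \<Rightarrow> ennreal"
  assumes [measurable]: "g \<in> borel_measurable borel" and a: "0 < a"
  shows "(\<integral>\<^sup>+x. aperture_int a g x \<partial>lborel) = ennreal (a ^ DIM('a)) * (\<integral>\<^sup>+x. aperture_int 1 g x \<partial>lborel)"
proof -
  have ball: "emeasure lborel (ball y (a * s)) = ennreal (a ^ DIM('a)) * emeasure lborel (ball y s)" for y :: 'a and s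
  proof (cases "0 \<le> s")
    case False
    then have "a * s \<le> 0" using a by (simp add: mult_le_0_iff)
    with False show ?thesis by (simp add: ball_empty)
  qed (use a in \<open>simp add: emeasure_ball_scale\<close>)
  have eq: "(\<integral>\<^sup>+x. aperture_int b g x \<partial>lborel) = (\<integral>\<^sup>+w. g w * emeasure lborel (ball (fst w) (b * snd w)) \<partial>lborel)" for b
    using nn_integral_mult_aperture_int[of g "\<lambda>_. 1" b] by simp
  show ?thesis
    unfolding eq ball[of "fst _" "snd _"] mult_1
    by (subst nn_integral_cmult[symmetric]) (auto simp: mult_ac emeasure_ball)
qed

text \<open>The large ball contains every point of the small one, so its average of h is a lower
  bound for the uncentred maximal function throughout the small ball. The factor a^n is the ratio of
  the volumes.\<close>

lemma nn_integral_aperture_int_duality: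
  fixes g :: "'a::euclidean_space \<times> real \<Rightarrow> ennreal"
  assumes [measurable]: "g \<in> borel_measurable borel" "h \<in> borel_measurable borel" and a: "1 \<le> a"
  shows "(\<integral>\<^sup>+x. h x * aperture_int a g x \<partial>lborel)
    \<le> ennreal (a ^ DIM('a)) * (\<integral>\<^sup>+x. maximal_fn h x * aperture_int 1 g x \<partial>lborel)"
proof -
  have ball: "(\<integral>\<^sup>+x\<in>ball y (a * s). h x \<partial>lborel)
     \<le> ennreal (a ^ DIM('a)) * (\<integral>\<^sup>+x\<in>ball y (1 * s). maximal_fn h x \<partial>lborel)" for y s
  proof (cases "0 < s")
    case False
    then have "a * s \<le> 0" using a by (simp add: mult_le_0_iff)
    then have "ball y (a * s) = {}" by simp
    then show ?thesis by (simp only: indicator_def) simp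
  next
    case True
    then have as: "0 < a * s" using a by simp
    define m where "m = (\<integral>\<^sup>+x\<in>ball y (a * s). h x \<partial>lborel) / emeasure lborel (ball y (a * s))"
    have sub: "ball y s \<subseteq> ball y (a * s)"
      using a True by (intro subset_ball) simp
    have "(\<integral>\<^sup>+x\<in>ball y (a * s). h x \<partial>lborel) = m * emeasure lborel (ball y (a * s))"
      using emeasure_ball_pos_finite[OF as, of y] unfolding m_def
      by (simp add: ennreal_divide_times)
    also have "\<dots> = ennreal (a ^ DIM('a)) * (m * emeasure lborel (ball y s))"
      using a True emeasure_ball_scale[of a s y y] by (simp add: mult.left_commute)
    also have "m * emeasure lborel (ball y s) = (\<integral>\<^sup>+x\<in>ball y s. m \<partial>lborel)"
      by (simp add: nn_integral_cmult_indicator)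
    also have "\<dots> \<le> (\<integral>\<^sup>+x\<in>ball y s. maximal_fn h x \<partial>lborel)"
    proof (intro nn_integral_mono)
      fix x
      have "m \<le> maximal_fn h x" if "x \<in> ball y s"
        unfolding m_def maximal_fn_def using that sub as
        by (intro SUP_upper2[of "(y, a * s)"]) auto
      then show "m * indicator (ball y s) x \<le> maximal_fn h x * indicator (ball y s) x"
        by (simp add: indicator_def)
    qed
    finally show ?thesis by (simp add: mult_left_mono)
  qed
  have "(\<integral>\<^sup>+x. h x * aperture_int a g x \<partial>lborel)
      = (\<integral>\<^sup>+w. g w * (\<integral>\<^sup>+x\<in>ball (fst w) (a * snd w). h x \<partial>lborel) \<partial>lborel)"
    by (rule nn_integral_mult_aperture_int) auto
  also have "\<dots> \<le> (\<integral>\<^sup>+w. ennreal (a ^ DIM('a)) * (g w * (\<integral>\<^sup>+x\<in>ball (fst w) (1 * snd w). maximal_fn h x \<partial>lborel)) \<partial>lborel)"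
    by (intro nn_integral_mono, subst mult.left_commute, intro mult_left_mono ball zero_le)
  also have "\<dots> = ennreal (a ^ DIM('a)) * (\<integral>\<^sup>+w. g w * (\<integral>\<^sup>+x\<in>ball (fst w) (1 * snd w). maximal_fn h x \<partial>lborel) \<partial>lborel)"
    by (rule nn_integral_cmult) measurable
  also have "(\<integral>\<^sup>+w. g w * (\<integral>\<^sup>+x\<in>ball (fst w) (1 * snd w). maximal_fn h x \<partial>lborel) \<partial>lborel)
      = (\<integral>\<^sup>+x. maximal_fn h x * aperture_int 1 g x \<partial>lborel)"
    by (rule nn_integral_mult_aperture_int[symmetric]) auto
  finally show ?thesis .
qed

text \<open>Young's inequality with crude constants, free of calculus: compare v with l u^(r-1).
  Whichever is smaller, the product is dominated by one of the two terms alone, and infinite values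
  cause no trouble.\<close>

lemma young_epow:
  assumes r: "1 < r" and l: "0 < l"
  shows "u * v \<le> ennreal l * epow u r + ennreal (l powr (- 1 / (r - 1))) * epow v (r / (r - 1))"
proof (cases "v \<le> ennreal l * epow u (r - 1)")
  case True
  then have "u * v \<le> u * (ennreal l * epow u (r - 1))" by (rule mult_left_mono) simp
  also have "\<dots> = ennreal l * epow u r"
    using epow_mult_self[of u "r - 1"] by (subst mult.left_commute) simp
  finally show ?thesis by (simp add: add_increasing2)
next
  case False
  let ?s = "1 / (r - 1)"
  have "ennreal (l powr ?s) * u = epow (ennreal l * epow u (r - 1)) ?s"
    using r l by (simp add: epow_mult epow_ennreal)
  also have "\<dots> \<le> epow v ?s"
    using False r by (intro epow_mono) auto
  finally have *: "ennreal (l powr ?s) * u \<le> epow v ?s" .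
  have "u = ennreal (l powr (- ?s)) * (ennreal (l powr ?s) * u)"
    using l by (simp add: mult.assoc[symmetric] ennreal_mult[symmetric] powr_add[symmetric])
  also have "\<dots> \<le> ennreal (l powr (- ?s)) * epow v ?s"
    using * by (rule mult_left_mono) simp
  finally have "u * v \<le> ennreal (l powr (- ?s)) * epow v ?s * v" by (rule mult_right_mono) simp
  also have "\<dots> = ennreal (l powr (- 1 / (r - 1))) * epow v (r / (r - 1))"
  proof -
    have "?s + 1 = r / (r - 1)" using r by (simp add: field_simps)
    then have "epow v ?s * v = epow v (r / (r - 1))"
      using epow_mult_self[of v ?s] by (simp add: mult.commute)
    then show ?thesis by (simp add: mult.assoc)
  qed
  finally show ?thesis by (simp add: add_increasing)
qed

text \<open>The cut-off acts both on the height and on the support, since either alone may leave an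
  infinite integral.\<close>

lemma SUP_truncation:
  fixes x :: "'a::euclidean_space"
  assumes "1 \<le> r"
  shows "(SUP N. epow (min u (ennreal (real N))) r * indicator (ball 0 (real N)) x) = epow u r"
proof (rule antisym)
  show "(SUP N. epow (min u (ennreal (real N))) r * indicator (ball 0 (real N)) x) \<le> epow u r"
    using assms by (intro SUP_least) (auto simp: indicator_def intro!: epow_mono)
  show "epow u r \<le> (SUP N. epow (min u (ennreal (real N))) r * indicator (ball 0 (real N)) x)" (is "_ \<le> ?S")
  proof (cases u)
    case (real v)
    obtain N :: nat where N: "max v (norm x) < real N" using reals_Archimedean2 by blast
    have "epow u r = epow (min u (ennreal (real N))) r * indicator (ball 0 (real N)) x"
      using N real by (simp add: min_def ennreal_le_iff)
    also have "\<dots> \<le> ?S" by (rule SUP_upper) simp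
    finally show ?thesis .
  next
    case top
    have "ennreal c < ?S" for c
    proof -
      obtain N :: nat where N: "max (max 1 c) (norm x) < real N" using reals_Archimedean2 by blast
      have "real N powr 1 \<le> real N powr r" using N assms by (intro powr_mono) auto
      then have "ennreal c < ennreal (real N powr r)" using N by (intro ennreal_lessI) auto
      also have "\<dots> = epow (min u (ennreal (real N))) r * indicator (ball 0 (real N)) x"
        using N top by (simp add: epow_ennreal min_def top_unique)
      also have "\<dots> \<le> ?S" by (rule SUP_upper) simp
      finally show ?thesis .
    qed
    then have "?S = top" by (metis ennreal_cases less_irrefl)
    then show ?thesis by (simp only: top_greatest)
  qed
qed

text \<open>Truncating the wide area functional makes its norm finite, so that the maximal function term,
  given the factor \<open>1/2\<close> by the choice of \<open>l\<close>, can be absorbed on the left.\<close>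
lemma nn_integral_epow_aperture_int_large:
  assumes a: "1 \<le> a" and r: "1 < r"
  shows "\<exists>C>0. \<forall>g :: 'a::euclidean_space \<times> real \<Rightarrow> ennreal. g \<in> borel_measurable borel \<longrightarrow>
    (\<integral>\<^sup>+x. epow (aperture_int a g x) r \<partial>lborel)
      \<le> ennreal C * (\<integral>\<^sup>+x. epow (aperture_int 1 g x) r \<partial>lborel)"
proof -
  define s where "s = r / (r - 1)"
  have s: "1 < s" using r by (simp add: s_def)
  define M where "M = 2 * 5 ^ DIM('a) * (s / (s - 1) * 2 powr (s - 1))"
  have M: "0 < M" using s by (simp add: M_def)
  define K where "K = a ^ DIM('a)"
  have K: "0 < K" using a by (simp add: K_def)
  \<comment> \<open>Solves l^(-1/(r-1)) = 1/(2KM). K is the constant of the duality estimate and M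
    that of the maximal inequality at the dual exponent s, so the Young term in the maximal function
    ends up with factor K M / (2KM) = 1/2.\<close>
  define l where "l = (1 / (2 * K * M)) powr (- (r - 1))"
  have l: "0 < l" using K M by (simp add: l_def)
  have l': "l powr (- 1 / (r - 1)) = 1 / (2 * K * M)"
  proof -
    have "- (r - 1) * (- 1 / (r - 1)) = 1" using r by (simp add: divide_simps)
    then show ?thesis using K M unfolding l_def powr_powr by simp
  qed
  show ?thesis
  proof (intro exI[of _ "2 * K * l"] conjI allI impI)
    show "0 < 2 * K * l" using K l by simp
    fix g :: "'a \<times> real \<Rightarrow> ennreal" assume [measurable]: "g \<in> borel_measurable borel"
    define A where "A = aperture_int 1 g"
    define A' where "A' = aperture_int a g"
    have [measurable]: "A \<in> borel_measurable borel" "A' \<in> borel_measurable borel"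
      by (simp_all add: A_def A'_def)
    define T where "T N x = epow (min (A' x) (ennreal (real N))) r * indicator (ball 0 (real N)) x" for N x
    have [measurable]: "T N \<in> borel_measurable borel" for N
      unfolding T_def by measurable
    have "(\<integral>\<^sup>+x. T N x \<partial>lborel) \<le> ennreal (2 * K * l) * (\<integral>\<^sup>+x. epow (A x) r \<partial>lborel)" for N
    proof -
      \<comment> \<open>The dual function: (r - 1) s = r gives h^s = \<open>T N\<close>, while h
        \<open>A'\<close> dominates \<open>T N\<close> because \<open>A'\<close> is at least its
        truncation.\<close>
      define h where "h x = epow (min (A' x) (ennreal (real N))) (r - 1) * indicator (ball 0 (real N)) x" for x
      have [measurable]: "h \<in> borel_measurable borel"
        unfolding h_def by measurable
      have "(\<integral>\<^sup>+x. T N x \<partial>lborel) \<le> (\<integral>\<^sup>+x. ennreal (real N powr r) * indicator (ball 0 (real N)) x \<partial>(lborel :: 'a measure))"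
        unfolding T_def using r
        by (intro nn_integral_mono mult_right_mono) (auto simp flip: epow_ennreal intro!: epow_mono)
      also have "\<dots> = ennreal (real N powr r) * emeasure lborel (ball (0::'a) (real N))"
        by (simp add: nn_integral_cmult_indicator)
      also have "\<dots> < top"
        using emeasure_lborel_ball_finite[of "0::'a" "real N"] by (simp add: ennreal_mult_less_top)
      finally have fin: "(\<integral>\<^sup>+x. T N x \<partial>lborel) < top" .
      have hs: "epow (h x) s = T N x" for x
        using r by (auto simp: h_def T_def s_def indicator_def)
      have "T N x \<le> h x * A' x" for x
      proof -
        let ?m = "min (A' x) (ennreal (real N))"
        have "epow ?m r = epow ?m (r - 1) * ?m"
          using epow_mult_self[of ?m "r - 1"] by (simp add: mult.commute)
        also have "\<dots> \<le> epow ?m (r - 1) * A' x" by (intro mult_left_mono) auto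
        finally show ?thesis by (auto simp: T_def h_def indicator_def)
      qed
      then have "(\<integral>\<^sup>+x. T N x \<partial>lborel) \<le> (\<integral>\<^sup>+x. h x * A' x \<partial>lborel)" by (rule nn_integral_mono)
      also have "\<dots> \<le> ennreal K * (\<integral>\<^sup>+x. maximal_fn h x * A x \<partial>lborel)"
        unfolding K_def A_def A'_def using a by (intro nn_integral_aperture_int_duality) auto
      also have "\<dots> \<le> ennreal K * (\<integral>\<^sup>+x. ennreal l * epow (A x) r + ennreal (1 / (2 * K * M)) * epow (maximal_fn h x) s \<partial>lborel)"
        using young_epow[OF r l] unfolding l'[symmetric] s_def
        by (intro mult_left_mono nn_integral_mono) (auto simp: mult.commute)
      also have "\<dots> = ennreal K * (ennreal l * (\<integral>\<^sup>+x. epow (A x) r \<partial>lborel)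
          + ennreal (1 / (2 * K * M)) * (\<integral>\<^sup>+x. epow (maximal_fn h x) s \<partial>lborel))"
        by (simp add: nn_integral_add nn_integral_cmult)
      also have "\<dots> \<le> ennreal K * (ennreal l * (\<integral>\<^sup>+x. epow (A x) r \<partial>lborel)
          + ennreal (1 / (2 * K * M)) * (ennreal M * (\<integral>\<^sup>+x. epow (h x) s \<partial>lborel)))"
        unfolding M_def using s by (intro mult_left_mono add_left_mono strong_type_maximal) auto
      also have "\<dots> = ennreal (K * l) * (\<integral>\<^sup>+x. epow (A x) r \<partial>lborel) + ennreal (1 / 2) * (\<integral>\<^sup>+x. T N x \<partial>lborel)"
      proof -
        have "K * (1 / (2 * K * M)) * M = 1 / 2" using K M by simp
        then show ?thesis
          using K M l unfolding hs
          by (simp only: distrib_left mult.assoc[symmetric] ennreal_mult[symmetric] less_imp_le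
              mult_nonneg_nonneg divide_nonneg_nonneg zero_le_one zero_le_numeral)
      qed
      finally have *: "(\<integral>\<^sup>+x. T N x \<partial>lborel) \<le>
          ennreal (K * l) * (\<integral>\<^sup>+x. epow (A x) r \<partial>lborel) + ennreal (1 / 2) * (\<integral>\<^sup>+x. T N x \<partial>lborel)" .
      show ?thesis
      \<comment> \<open>When the narrow integral is infinite there is nothing to show; otherwise
        both integrals are real numbers and half of the left one may be subtracted.\<close>
      proof (cases "\<integral>\<^sup>+x. epow (A x) r \<partial>lborel")
        case top
        then show ?thesis using mult_pos_pos[OF K l] by (simp add: ennreal_mult_top ennreal_eq_0_iff)
      next
        case (real c)
        moreover obtain d where "(\<integral>\<^sup>+x. T N x \<partial>lborel) = ennreal d" "0 \<le> d"
          using fin by (cases "\<integral>\<^sup>+x. T N x \<partial>lborel") auto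
        ultimately show ?thesis
          using * K l
          by (simp add: ennreal_mult[symmetric] ennreal_plus[symmetric] ennreal_le_iff del: ennreal_plus ennreal_half)
      qed
    qed
    then have "(SUP N. \<integral>\<^sup>+x. T N x \<partial>lborel) \<le> ennreal (2 * K * l) * (\<integral>\<^sup>+x. epow (A x) r \<partial>lborel)"
      by (rule SUP_least)
    also have "(SUP N. \<integral>\<^sup>+x. T N x \<partial>lborel) = (\<integral>\<^sup>+x. (SUP N. T N x) \<partial>lborel)"
    proof (rule nn_integral_monotone_convergence_SUP[symmetric])
      show "incseq T"
        using r unfolding T_def incseq_def le_fun_def
        by (intro allI impI mult_mono epow_mono) (auto simp: indicator_def intro: min.coboundedI2)
    qed simp
    also have "\<dots> = (\<integral>\<^sup>+x. epow (A' x) r \<partial>lborel)"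
      unfolding T_def using r by (simp add: SUP_truncation)
    finally show "(\<integral>\<^sup>+x. epow (aperture_int a g x) r \<partial>lborel)
      \<le> ennreal (2 * K * l) * (\<integral>\<^sup>+x. epow (aperture_int 1 g x) r \<partial>lborel)"
      unfolding A_def A'_def .
  qed
qed

lemma change_of_aperture:
  assumes a: "1 \<le> a" and r: "0 < r"
  shows "\<exists>C>0. \<forall>g :: 'a::euclidean_space \<times> real \<Rightarrow> ennreal. g \<in> borel_measurable borel \<longrightarrow>
    (\<integral>\<^sup>+x. epow (aperture_int a g x) r \<partial>lborel)
      \<le> ennreal C * (\<integral>\<^sup>+x. epow (aperture_int 1 g x) r \<partial>lborel)"
proof (rule linorder_cases[of r 1])
  assume "r < 1"
  moreover have "0 < 2 * a ^ DIM('a) * 5 ^ DIM('a) + 2 * a ^ DIM('a) * (r / (1 - r))"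
    using a r \<open>r < 1\<close> by (intro add_pos_pos mult_pos_pos) auto
  ultimately show ?thesis
    using nn_integral_epow_aperture_int_small[OF _ a r] by blast
next
  assume "r = 1"
  then show ?thesis
    using a nn_integral_aperture_int[of "_ :: 'a \<times> real \<Rightarrow> ennreal" a] by (intro exI[of _ "a ^ DIM('a)"]) auto
next
  assume "1 < r"
  then show ?thesis by (rule nn_integral_epow_aperture_int_large[OF a])
qed

section \<open>Whitney averages\<close>

lemma mem_whitney:
  "v \<in> whitney \<alpha>1 \<alpha>2 w \<longleftrightarrow>
     dist (fst v) (fst w) < \<alpha>1 * snd w \<and> snd w / \<alpha>2 < snd v \<and> snd v < \<alpha>2 * snd w"
  by (cases v; cases w) (auto simp: whitney_def)

lemma emeasure_Times:
  fixes A :: "'a::euclidean_space set" and B :: "'b::euclidean_space set"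
  assumes "A \<in> sets borel" "B \<in> sets borel"
  shows "emeasure lborel (A \<times> B) = emeasure lborel A * emeasure lborel B"
  using assms unfolding lborel_prod[symmetric] by (intro lborel.emeasure_pair_measure_Times) auto

lemma emeasure_ball_Times_Ioo:
  fixes c :: "'a::euclidean_space"
  assumes "0 \<le> r" "l \<le> u"
  shows "emeasure lborel (ball c r \<times> {l<..<u}) = ennreal (unit_ball_vol DIM('a) * r ^ DIM('a) * (u - l))"
  using assms by (simp add: emeasure_Times emeasure_ball ennreal_mult)

lemma whitney_eq_Times: "whitney \<alpha>1 \<alpha>2 (y, t) = ball y (\<alpha>1 * t) \<times> {t / \<alpha>2<..<\<alpha>2 * t}"
  by (auto simp: whitney_def dist_commute)

locale whitney_parameters =
  fixes \<alpha>1 \<alpha>2 :: real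
  assumes \<alpha>1: "0 < \<alpha>1" and \<alpha>1_less: "\<alpha>1 < 1" and \<alpha>2: "1 < \<alpha>2"
begin

lemma inverse_\<alpha>2_less: "1 / \<alpha>2 < \<alpha>2"
proof -
  have "1 / \<alpha>2 < 1" using \<alpha>2 by simp
  then show ?thesis using \<alpha>2 by linarith
qed

text \<open>The volume of a Whitney box at height 1; the dummy argument carries the
  dimension.\<close>

definition whitney_const :: "'a::euclidean_space itself \<Rightarrow> real" where
  "whitney_const _ = unit_ball_vol DIM('a) * \<alpha>1 ^ DIM('a) * (\<alpha>2 - 1 / \<alpha>2)"

lemma whitney_const_pos: "0 < whitney_const TYPE('a::euclidean_space)"
  using \<alpha>1 inverse_\<alpha>2_less by (simp add: whitney_const_def)

lemma emeasure_whitney: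
  assumes "0 < t"
  shows "emeasure lborel (whitney \<alpha>1 \<alpha>2 (y :: 'a::euclidean_space, t))
    = ennreal (whitney_const TYPE('a) * t ^ (DIM('a) + 1))"
proof -
  have "t / \<alpha>2 \<le> t * 1" using \<alpha>2 assms by (simp add: divide_le_eq mult_left_mono)
  also have "\<dots> \<le> \<alpha>2 * t" using \<alpha>2 assms by simp
  finally have "t / \<alpha>2 \<le> \<alpha>2 * t" .
  then show ?thesis
    unfolding whitney_eq_Times whitney_const_def using \<alpha>1 assms
    by (subst emeasure_ball_Times_Ioo) (auto simp: power_mult_distrib algebra_simps)
qed

definition solid_avg :: "('a::euclidean_space \<times> real \<Rightarrow> ennreal) \<Rightarrow> 'a \<times> real \<Rightarrow> ennreal" where
  "solid_avg G w = (\<integral>\<^sup>+v\<in>whitney \<alpha>1 \<alpha>2 w. G v \<partial>lborel) / emeasure lborel (whitney \<alpha>1 \<alpha>2 w)"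

text \<open>The total weight with which the value at v enters when averages over all centres in U
  are integrated against t^(-k). The exponent n + 1 + k combines the box volume with that weight;
  cones use k = n + 1 and tents k = 1.\<close>

definition whitney_kernel :: "('a::euclidean_space \<times> real) set \<Rightarrow> nat \<Rightarrow> 'a \<times> real \<Rightarrow> ennreal" where
  "whitney_kernel U k v = (\<integral>\<^sup>+w\<in>U. indicator (whitney \<alpha>1 \<alpha>2 w) v *
     ennreal (1 / (whitney_const TYPE('a) * snd w ^ (DIM('a) + 1 + k))) \<partial>lborel)"

lemma solid_avg_divide:
  fixes G :: "'a::euclidean_space \<times> real \<Rightarrow> ennreal"
  assumes [measurable]: "G \<in> borel_measurable borel" and w: "0 < snd w"
  shows "solid_avg G w / ennreal (snd w ^ k) = (\<integral>\<^sup>+v. G v * indicator (whitney \<alpha>1 \<alpha>2 w) v *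
     ennreal (1 / (whitney_const TYPE('a) * snd w ^ (DIM('a) + 1 + k))) \<partial>lborel)"
proof -
  obtain y t where [simp]: "w = (y, t)" by (cases w)
  have t: "0 < t" using w by simp
  let ?K = "whitney_const TYPE('a)"
  have K: "0 < ?K" by (rule whitney_const_pos)
  have [measurable]: "whitney \<alpha>1 \<alpha>2 w \<in> sets borel"
    by (simp add: whitney_eq_Times borel_Times)
  have "inverse (ennreal (?K * t ^ (DIM('a) + 1))) * inverse (ennreal (t ^ k))
      = ennreal (1 / (?K * t ^ (DIM('a) + 1 + k)))"
    using K t by (simp add: inverse_ennreal ennreal_mult[symmetric] power_add divide_simps)
  then have "solid_avg G w / ennreal (snd w ^ k)
      = (\<integral>\<^sup>+v\<in>whitney \<alpha>1 \<alpha>2 w. G v \<partial>lborel) * ennreal (1 / (?K * snd w ^ (DIM('a) + 1 + k)))"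
    using t by (simp only: solid_avg_def divide_ennreal_def mult.assoc emeasure_whitney \<open>w = (y, t)\<close> snd_conv)
  also have "\<dots> = (\<integral>\<^sup>+v. G v * indicator (whitney \<alpha>1 \<alpha>2 w) v * ennreal (1 / (?K * snd w ^ (DIM('a) + 1 + k))) \<partial>lborel)"
    by (rule nn_integral_multc[symmetric]) measurable
  finally show ?thesis .
qed

lemma nn_integral_solid_avg:
  fixes G :: "'a::euclidean_space \<times> real \<Rightarrow> ennreal"
  assumes [measurable]: "G \<in> borel_measurable borel" "U \<in> sets borel" and U: "U \<subseteq> half_space"
  shows "(\<integral>\<^sup>+w\<in>U. solid_avg G w / ennreal (snd w ^ k) \<partial>lborel) = (\<integral>\<^sup>+v. G v * whitney_kernel U k v \<partial>lborel)"
proof -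
  let ?K = "whitney_const TYPE('a)"
  let ?c = "\<lambda>w. ennreal (1 / (?K * snd w ^ (DIM('a) + 1 + k)))"
  have [measurable]: "Measurable.pred (lborel \<Otimes>\<^sub>M lborel) (\<lambda>p :: ('a \<times> real) \<times> ('a \<times> real). snd p \<in> whitney \<alpha>1 \<alpha>2 (fst p))"
    "Measurable.pred (lborel \<Otimes>\<^sub>M lborel) (\<lambda>p :: ('a \<times> real) \<times> ('a \<times> real). fst p \<in> whitney \<alpha>1 \<alpha>2 (snd p))"
    "\<And>v. Measurable.pred borel (\<lambda>w :: 'a \<times> real. v \<in> whitney \<alpha>1 \<alpha>2 w)"
    unfolding mem_whitney by measurable
  have "(\<integral>\<^sup>+w\<in>U. solid_avg G w / ennreal (snd w ^ k) \<partial>lborel)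
     = (\<integral>\<^sup>+w. (\<integral>\<^sup>+v. G v * indicator (whitney \<alpha>1 \<alpha>2 w) v * ?c w * indicator U w \<partial>lborel) \<partial>lborel)"
  proof (rule nn_integral_cong)
    fix w :: "'a \<times> real"
    have [measurable]: "whitney \<alpha>1 \<alpha>2 w \<in> sets borel"
      by (cases w) (simp add: whitney_eq_Times borel_Times)
    show "solid_avg G w / ennreal (snd w ^ k) * indicator U w
        = (\<integral>\<^sup>+v. G v * indicator (whitney \<alpha>1 \<alpha>2 w) v * ?c w * indicator U w \<partial>lborel)"
    proof (cases "w \<in> U")
      case True
      then have "0 < snd w" using U by (auto simp: half_space_def)
      with True show ?thesis by (simp only: solid_avg_divide[OF assms(1)] indicator_simps mult_1_right)
    qed simp
  qed
  also have "\<dots> = (\<integral>\<^sup>+v. (\<integral>\<^sup>+w. G v * indicator (whitney \<alpha>1 \<alpha>2 w) v * ?c w * indicator U w \<partial>lborel) \<partial>lborel)"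
    by (rule lborel_pair.Fubini') measurable
  also have "\<dots> = (\<integral>\<^sup>+v. G v * whitney_kernel U k v \<partial>lborel)"
  proof (rule nn_integral_cong)
    fix v :: "'a \<times> real"
    have "(\<lambda>w. indicator (whitney \<alpha>1 \<alpha>2 w) v * ?c w * indicator U w) \<in> borel_measurable lborel"
      by measurable
    then show "(\<integral>\<^sup>+w. G v * indicator (whitney \<alpha>1 \<alpha>2 w) v * ?c w * indicator U w \<partial>lborel) = G v * whitney_kernel U k v"
      unfolding whitney_kernel_def by (subst nn_integral_cmult[symmetric]) (simp_all add: mult.assoc)
  qed
  finally show ?thesis .
qed

text \<open>If v = (z, s) lies in the box of (y, t), then s/\<alpha>2 < t < \<alpha>2 s and |y - z|
  < \<alpha>1 \<alpha>2 s. The centres therefore fill at most a box of volume \<alpha>2^n s^(n+1)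
  times \<open>whitney_const\<close>, and t > s/\<alpha>2 costs a further \<alpha>2^(n+1+k).\<close>

lemma whitney_kernel_le:
  fixes v :: "'a::euclidean_space \<times> real"
  assumes U: "U \<subseteq> half_space"
  shows "whitney_kernel U k v \<le> ennreal (\<alpha>2 ^ (2 * DIM('a) + 1 + k)) / ennreal (snd v ^ k)"
proof -
  obtain z s where [simp]: "v = (z, s)" by (cases v)
  let ?K = "whitney_const TYPE('a)"
  have K: "0 < ?K" by (rule whitney_const_pos)
  show ?thesis
  proof (cases "0 < s")
    case False
    have "v \<notin> whitney \<alpha>1 \<alpha>2 w" if "w \<in> U" for w
    proof
      assume "v \<in> whitney \<alpha>1 \<alpha>2 w"
      moreover have "0 < snd w" using that U by (auto simp: half_space_def)
      then have "0 < snd w / \<alpha>2" using \<alpha>2 by simp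
      ultimately show False using False by (simp add: mem_whitney)
    qed
    then have "indicator (whitney \<alpha>1 \<alpha>2 w) v * c * indicator U w = 0" for w and c :: ennreal
      by (cases "w \<in> U") auto
    then show ?thesis by (simp only: whitney_kernel_def nn_integral_const mult_zero_left zero_le)
  next
    case s: True
    let ?Q = "ball z (\<alpha>1 * \<alpha>2 * s) \<times> {s / \<alpha>2<..<\<alpha>2 * s}"
    let ?c = "1 / (?K * (s / \<alpha>2) ^ (DIM('a) + 1 + k))"
    have "whitney_kernel U k v \<le> (\<integral>\<^sup>+w. ennreal ?c * indicator ?Q w \<partial>lborel)"
      unfolding whitney_kernel_def
    proof (rule nn_integral_mono)
      fix w :: "'a \<times> real"
      obtain y t where [simp]: "w = (y, t)" by (cases w)
      show "indicator (whitney \<alpha>1 \<alpha>2 w) v * ennreal (1 / (?K * snd w ^ (DIM('a) + 1 + k))) * indicator U w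
          \<le> ennreal ?c * indicator ?Q w"
      proof (cases "v \<in> whitney \<alpha>1 \<alpha>2 w \<and> w \<in> U")
        case True
        then have h: "0 < t" "dist z y < \<alpha>1 * t" "t / \<alpha>2 < s" "s < \<alpha>2 * t"
          using U by (auto simp: mem_whitney half_space_def)
        then have t: "s / \<alpha>2 < t" "t < \<alpha>2 * s" using \<alpha>2 by (auto simp: divide_less_eq mult.commute)
        then have "\<alpha>1 * t < \<alpha>1 * \<alpha>2 * s" using \<alpha>1 by simp
        with h t have "w \<in> ?Q" by (simp add: dist_commute)
        moreover have "1 / (?K * t ^ (DIM('a) + 1 + k)) \<le> ?c"
          using t s K \<alpha>2 h by (intro divide_left_mono mult_left_mono power_mono mult_pos_pos zero_less_power) auto
        ultimately show ?thesis using True by (simp add: ennreal_leI)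
      qed auto
    qed
    also have "\<dots> = ennreal ?c * emeasure lborel ?Q"
      by (subst nn_integral_cmult_indicator) (auto simp: borel_Times)
    also have "emeasure lborel ?Q = ennreal (unit_ball_vol DIM('a) * (\<alpha>1 * \<alpha>2 * s) ^ DIM('a) * (\<alpha>2 * s - s / \<alpha>2))"
    proof (rule emeasure_ball_Times_Ioo)
      have "s / \<alpha>2 \<le> s * 1" using \<alpha>2 s by (simp add: divide_le_eq mult_left_mono)
      also have "\<dots> \<le> \<alpha>2 * s" using \<alpha>2 s by simp
      finally show "s / \<alpha>2 \<le> \<alpha>2 * s" .
    qed (use \<alpha>1 \<alpha>2 s in simp)
    also have "unit_ball_vol DIM('a) * (\<alpha>1 * \<alpha>2 * s) ^ DIM('a) * (\<alpha>2 * s - s / \<alpha>2) = ?K * \<alpha>2 ^ DIM('a) * s ^ (DIM('a) + 1)"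
      by (simp add: whitney_const_def power_mult_distrib field_simps)
    also have "ennreal ?c * ennreal (?K * \<alpha>2 ^ DIM('a) * s ^ (DIM('a) + 1)) = ennreal (?c * (?K * \<alpha>2 ^ DIM('a) * s ^ (DIM('a) + 1)))"
      using K s \<alpha>2 by (intro ennreal_mult[symmetric]) auto
    also have "?c * (?K * \<alpha>2 ^ DIM('a) * s ^ (DIM('a) + 1)) = \<alpha>2 ^ (2 * DIM('a) + 1 + k) / s ^ k"
      using K s \<alpha>2 by (simp add: power_divide power_add mult_2_right field_simps)
    also have "ennreal \<dots> = ennreal (\<alpha>2 ^ (2 * DIM('a) + 1 + k)) / ennreal (snd v ^ k)"
      using s \<alpha>2 by (simp add: divide_ennreal)
    finally show ?thesis .
  qed
qed

lemma nn_integral_solid_avg_le: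
  fixes G :: "'a::euclidean_space \<times> real \<Rightarrow> ennreal"
  assumes [measurable]: "G \<in> borel_measurable borel" "U \<in> sets borel" "V \<in> sets borel"
    and U: "U \<subseteq> half_space" and UV: "\<And>w. w \<in> U \<Longrightarrow> whitney \<alpha>1 \<alpha>2 w \<subseteq> V"
  shows "(\<integral>\<^sup>+w\<in>U. solid_avg G w / ennreal (snd w ^ k) \<partial>lborel)
    \<le> ennreal (\<alpha>2 ^ (2 * DIM('a) + 1 + k)) * (\<integral>\<^sup>+v\<in>V. G v / ennreal (snd v ^ k) \<partial>lborel)"
proof -
  have "(\<integral>\<^sup>+w\<in>U. solid_avg G w / ennreal (snd w ^ k) \<partial>lborel) = (\<integral>\<^sup>+v. G v * whitney_kernel U k v \<partial>lborel)"
    by (rule nn_integral_solid_avg) (use U in auto)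
  also have "\<dots> \<le> (\<integral>\<^sup>+v. ennreal (\<alpha>2 ^ (2 * DIM('a) + 1 + k)) * (G v / ennreal (snd v ^ k) * indicator V v) \<partial>lborel)"
  proof (rule nn_integral_mono)
    fix v :: "'a \<times> real"
    show "G v * whitney_kernel U k v \<le> ennreal (\<alpha>2 ^ (2 * DIM('a) + 1 + k)) * (G v / ennreal (snd v ^ k) * indicator V v)"
    proof (cases "v \<in> V")
      case True
      have "G v * whitney_kernel U k v \<le> G v * (ennreal (\<alpha>2 ^ (2 * DIM('a) + 1 + k)) / ennreal (snd v ^ k))"
        by (intro mult_left_mono whitney_kernel_le U) simp
      with True show ?thesis by (simp add: divide_ennreal_def mult_ac)
    next
      case False
      then have "indicator (whitney \<alpha>1 \<alpha>2 w) v * c * indicator U w = 0" for w and c :: ennreal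
        using UV[of w] by (cases "w \<in> U") (auto simp: indicator_def)
      then have "whitney_kernel U k v = 0" by (simp only: whitney_kernel_def nn_integral_const mult_zero_left)
      then show ?thesis by simp
    qed
  qed
  also have "\<dots> = ennreal (\<alpha>2 ^ (2 * DIM('a) + 1 + k)) * (\<integral>\<^sup>+v\<in>V. G v / ennreal (snd v ^ k) \<partial>lborel)"
    by (rule nn_integral_cmult) measurable
  finally show ?thesis .
qed

text \<open>On the given box of centres t < \<alpha>2 s bounds the density from below. Its centre c
  is free and its radius is only half of \<alpha>1 s, which leaves room to shift it into a cone; the
  halving accounts for 2^n.\<close>

lemma whitney_kernel_ge:
  fixes v :: "'a::euclidean_space \<times> real"
  assumes v: "0 < snd v"
    and Q: "ball c (\<alpha>1 * snd v / 2) \<times> {snd v<..<\<alpha>2 * snd v} \<subseteq> {w\<in>U. v \<in> whitney \<alpha>1 \<alpha>2 w}"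
  shows "ennreal ((\<alpha>2 - 1) / (2 ^ DIM('a) * (\<alpha>2 - 1 / \<alpha>2) * \<alpha>2 ^ (DIM('a) + 1 + k))) / ennreal (snd v ^ k)
    \<le> whitney_kernel U k v"
proof -
  obtain z s where [simp]: "v = (z, s)" by (cases v)
  have s: "0 < s" using v by simp
  let ?K = "whitney_const TYPE('a)"
  have K: "0 < ?K" by (rule whitney_const_pos)
  let ?Q = "ball c (\<alpha>1 * s / 2) \<times> {s<..<\<alpha>2 * s}"
  let ?c = "1 / (?K * (\<alpha>2 * s) ^ (DIM('a) + 1 + k))"
  have eq: "?c * (unit_ball_vol DIM('a) * (\<alpha>1 * s / 2) ^ DIM('a) * (\<alpha>2 * s - s))
      = (\<alpha>2 - 1) / (2 ^ DIM('a) * (\<alpha>2 - 1 / \<alpha>2) * \<alpha>2 ^ (DIM('a) + 1 + k)) / s ^ k"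
  proof -
    have "unit_ball_vol DIM('a) * (\<alpha>1 * s / 2) ^ DIM('a) * (\<alpha>2 * s - s)
      = unit_ball_vol DIM('a) * \<alpha>1 ^ DIM('a) * ((\<alpha>2 - 1) * s ^ (DIM('a) + 1) / 2 ^ DIM('a))"
      by (simp add: power_mult_distrib power_divide field_simps)
    moreover have "?c = 1 / (unit_ball_vol DIM('a) * \<alpha>1 ^ DIM('a) * ((\<alpha>2 - 1 / \<alpha>2) * \<alpha>2 ^ (DIM('a) + 1 + k) * (s ^ (DIM('a) + 1) * s ^ k)))"
      unfolding whitney_const_def power_mult_distrib by (simp add: power_add mult_ac)
    \<comment> \<open>The cancellation is done with opaque factors, so that simplification does not
      take the powers apart.\<close>
    moreover have "1 / (P * (D * E * (S * X))) * (P * (b * S / T)) = b / (T * D * E) / X"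
      if "P \<noteq> 0" "D \<noteq> 0" "E \<noteq> 0" "S \<noteq> 0" "X \<noteq> 0" "T \<noteq> 0" for P D E S X T b :: real
      using that by (simp add: field_simps)
    moreover have "unit_ball_vol DIM('a) * \<alpha>1 ^ DIM('a) \<noteq> 0" "\<alpha>2 - 1 / \<alpha>2 \<noteq> 0"
      using K \<alpha>1 unfolding whitney_const_def by auto
    moreover have "\<alpha>2 ^ (DIM('a) + 1 + k) \<noteq> 0" "s ^ (DIM('a) + 1) \<noteq> 0" "s ^ k \<noteq> 0" "(2::real) ^ DIM('a) \<noteq> 0"
      using s \<alpha>2 by auto
    ultimately show ?thesis by metis
  qed
  have "ennreal ((\<alpha>2 - 1) / (2 ^ DIM('a) * (\<alpha>2 - 1 / \<alpha>2) * \<alpha>2 ^ (DIM('a) + 1 + k))) / ennreal (snd v ^ k)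
     = ennreal (?c * (unit_ball_vol DIM('a) * (\<alpha>1 * s / 2) ^ DIM('a) * (\<alpha>2 * s - s)))"
  proof -
    have "1 / \<alpha>2 \<le> \<alpha>2" using \<alpha>2 by (meson divide_le_eq_1 less_imp_le less_trans order_trans zero_less_one)
    then show ?thesis unfolding eq using s \<alpha>2 by (subst divide_ennreal) auto
  qed
  also have "\<dots> = ennreal ?c * emeasure lborel ?Q"
    using \<alpha>1 \<alpha>2 s K by (subst emeasure_ball_Times_Ioo) (auto simp: ennreal_mult[symmetric])
  also have "\<dots> = (\<integral>\<^sup>+w. ennreal ?c * indicator ?Q w \<partial>lborel)"
    by (subst nn_integral_cmult_indicator) (auto simp: borel_Times)
  also have "\<dots> \<le> whitney_kernel U k v"
    unfolding whitney_kernel_def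
  proof (rule nn_integral_mono)
    fix w :: "'a \<times> real"
    obtain y t where [simp]: "w = (y, t)" by (cases w)
    show "ennreal ?c * indicator ?Q w
      \<le> indicator (whitney \<alpha>1 \<alpha>2 w) v * ennreal (1 / (?K * snd w ^ (DIM('a) + 1 + k))) * indicator U w"
    proof (cases "w \<in> ?Q")
      case True
      then have "w \<in> {w\<in>U. v \<in> whitney \<alpha>1 \<alpha>2 w}" using Q by (intro subsetD[OF Q]) simp
      then have "w \<in> U" "v \<in> whitney \<alpha>1 \<alpha>2 w" by simp_all
      moreover have t: "s < t" "t < \<alpha>2 * s" using True by auto
      have "?c \<le> 1 / (?K * t ^ (DIM('a) + 1 + k))"
        using t s K \<alpha>2 by (intro divide_left_mono mult_left_mono power_mono mult_pos_pos zero_less_power) auto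
      ultimately show ?thesis using True by (simp add: ennreal_leI)
    qed simp
  qed
  finally show ?thesis .
qed

text \<open>The constant precedes U and V, because one constant has to serve the cones at all
  vertices and the tents over all balls.\<close>

lemma nn_integral_le_solid_avg:
  shows "\<exists>C>0. \<forall>(G :: 'a::euclidean_space \<times> real \<Rightarrow> ennreal) U V. G \<in> borel_measurable borel \<longrightarrow> U \<in> sets borel \<longrightarrow>
    V \<in> sets borel \<longrightarrow> U \<subseteq> half_space \<longrightarrow> V \<subseteq> half_space \<longrightarrow>
    (\<forall>v\<in>V. \<exists>c. ball c (\<alpha>1 * snd v / 2) \<times> {snd v<..<\<alpha>2 * snd v} \<subseteq> {w\<in>U. v \<in> whitney \<alpha>1 \<alpha>2 w}) \<longrightarrow>
    (\<integral>\<^sup>+v\<in>V. G v / ennreal (snd v ^ k) \<partial>lborel)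
    \<le> ennreal C * (\<integral>\<^sup>+w\<in>U. solid_avg G w / ennreal (snd w ^ k) \<partial>lborel)"
proof -
  define \<kappa> where "\<kappa> = (\<alpha>2 - 1) / (2 ^ DIM('a) * (\<alpha>2 - 1 / \<alpha>2) * \<alpha>2 ^ (DIM('a) + 1 + k))"
  have \<kappa>: "0 < \<kappa>"
    unfolding \<kappa>_def using \<alpha>2 inverse_\<alpha>2_less by (intro divide_pos_pos mult_pos_pos) auto
  show ?thesis
  proof (intro exI[of _ "1 / \<kappa>"] conjI allI impI)
    fix G :: "'a \<times> real \<Rightarrow> ennreal" and U V :: "('a \<times> real) set"
    assume [measurable]: "G \<in> borel_measurable borel" "U \<in> sets borel" "V \<in> sets borel"
      and U: "U \<subseteq> half_space" and V: "V \<subseteq> half_space"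
      and Q: "\<forall>v\<in>V. \<exists>c. ball c (\<alpha>1 * snd v / 2) \<times> {snd v<..<\<alpha>2 * snd v} \<subseteq> {w\<in>U. v \<in> whitney \<alpha>1 \<alpha>2 w}"
    have "(\<integral>\<^sup>+v\<in>V. G v / ennreal (snd v ^ k) \<partial>lborel)
       = ennreal (1 / \<kappa>) * (ennreal \<kappa> * (\<integral>\<^sup>+v\<in>V. G v / ennreal (snd v ^ k) \<partial>lborel))"
      using \<kappa> by (simp add: mult.assoc[symmetric] ennreal_mult[symmetric])
    also have "ennreal \<kappa> * (\<integral>\<^sup>+v\<in>V. G v / ennreal (snd v ^ k) \<partial>lborel)
       = (\<integral>\<^sup>+v. ennreal \<kappa> * (G v / ennreal (snd v ^ k) * indicator V v) \<partial>lborel)"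
      by (rule nn_integral_cmult[symmetric]) measurable
    also have "\<dots> \<le> (\<integral>\<^sup>+v. G v * whitney_kernel U k v \<partial>lborel)"
    proof (rule nn_integral_mono)
      fix v :: "'a \<times> real"
      show "ennreal \<kappa> * (G v / ennreal (snd v ^ k) * indicator V v) \<le> G v * whitney_kernel U k v"
      proof (cases "v \<in> V")
        case True
        then have "0 < snd v" using V by (auto simp: half_space_def)
        with Q True have "ennreal \<kappa> / ennreal (snd v ^ k) \<le> whitney_kernel U k v"
          unfolding \<kappa>_def using whitney_kernel_ge by blast
        then have "G v * (ennreal \<kappa> / ennreal (snd v ^ k)) \<le> G v * whitney_kernel U k v"
          by (rule mult_left_mono) simp
        with True show ?thesis by (simp add: divide_ennreal_def mult_ac)
      qed simp
    qed
    also have "\<dots> = (\<integral>\<^sup>+w\<in>U. solid_avg G w / ennreal (snd w ^ k) \<partial>lborel)"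
      by (rule nn_integral_solid_avg[symmetric]) (use U in auto)
    finally show "(\<integral>\<^sup>+v\<in>V. G v / ennreal (snd v ^ k) \<partial>lborel)
      \<le> ennreal (1 / \<kappa>) * (\<integral>\<^sup>+w\<in>U. solid_avg G w / ennreal (snd w ^ k) \<partial>lborel)"
      by (simp add: mult_left_mono)
  qed (use \<kappa> in simp)
qed

end

section \<open>Cones, tents and the tent space functionals\<close>

lemma open_cone: "open (cone x)"
  unfolding cone_def case_prod_beta by (intro open_Collect_less continuous_intros)

lemma cone_subset_half_space: "cone x \<subseteq> half_space"
proof
  fix w assume "w \<in> cone x"
  then obtain y t where w: "w = (y, t)" "dist y x < t" by (auto simp: cone_def)
  with zero_le_dist[of y x] have "0 < t" by linarith
  with w show "w \<in> half_space" by (simp add: half_space_def)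
qed

lemma mem_tent_ball:
  fixes c :: "'a::euclidean_space"
  shows "w \<in> tent (ball c \<rho>) \<longleftrightarrow> 0 < snd w \<and> dist (fst w) c + snd w \<le> \<rho>"
  by (cases w) (auto simp: tent_def ball_subset_ball_iff)

lemma tent_ball_measurable [measurable]: "tent (ball c \<rho>) \<in> sets borel" for c :: "'a::euclidean_space"
proof -
  have "tent (ball c \<rho>) = {w. 0 < snd w} \<inter> {w. dist (fst w) c + snd w \<le> \<rho>}"
    by (auto simp: mem_tent_ball)
  then show ?thesis
    by (simp only:) (intro sets.Int borel_open borel_closed open_Collect_less closed_Collect_le continuous_intros)
qed

lemma tent_subset_half_space: "tent B \<subseteq> half_space"
  by (auto simp: tent_def half_space_def)

lemma area_fn_eq:
  fixes F :: "'a::euclidean_space \<times> real \<Rightarrow> ennreal"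
  shows "area_fn q F x = epow (aperture_int 1
    (\<lambda>v. epow (F v) (enn2real q) / ennreal (snd v ^ (DIM('a) + 1))) x) (1 / enn2real q)"
  unfolding area_fn_def aperture_int_def cone_def by (simp add: nn_integral_completion case_prod_beta)

lemma carleson_fn_eq:
  fixes F :: "'a::euclidean_space \<times> real \<Rightarrow> ennreal"
  shows "carleson_fn q F x = (SUP B \<in> {ball c \<rho> | c \<rho>. 0 < \<rho> \<and> x \<in> ball c \<rho>}.
       epow (emeasure lborel B) (- 1 / enn2real q) *
       epow (\<integral>\<^sup>+v\<in>tent B. epow (F v) (enn2real q) / ennreal (snd v ^ 1) \<partial>lborel) (1 / enn2real q))"
  unfolding carleson_fn_def
  by (intro SUP_cong refl) (auto simp: nn_integral_completion case_prod_beta)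

text \<open>Every ball has positive measure, so the essential supremum of the Carleson functional
  controls all balls and not only almost all vertices.\<close>
lemma carleson_ball_le:
  fixes F :: "'a::euclidean_space \<times> real \<Rightarrow> ennreal"
  assumes \<rho>: "0 < \<rho>"
  shows "epow (emeasure lborel (ball c \<rho>)) (- 1 / enn2real q) *
       epow (\<integral>\<^sup>+v\<in>tent (ball c \<rho>). epow (F v) (enn2real q) / ennreal (snd v ^ 1) \<partial>lborel) (1 / enn2real q)
     \<le> ess_sup_on UNIV (carleson_fn q F)" (is "?L \<le> ?S")
proof -
  have "\<exists>x\<in>ball c \<rho>. carleson_fn q F x \<le> ?S"
  proof (rule ccontr)
    assume "\<not> ?thesis"
    moreover have "AE x in lborel. carleson_fn q F x \<le> ?S"
      using AE_ess_sup_on[of UNIV "carleson_fn q F"] unfolding AE_lebesgue_iff by simp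
    ultimately have "AE x in lborel. x \<notin> ball c \<rho>" by (auto elim: eventually_mono)
    then have "emeasure lborel (ball c \<rho>) = 0"
      by (subst (asm) AE_iff_measurable[OF _ refl]) (auto simp: ball_def)
    then show False using emeasure_ball_pos_finite[OF \<rho>, of c] by simp
  qed
  then obtain x where x: "x \<in> ball c \<rho>" "carleson_fn q F x \<le> ?S" by blast
  have "?L \<le> carleson_fn q F x"
    unfolding carleson_fn_eq using x(1) \<rho> by (intro SUP_upper) blast
  with x(2) show ?thesis by simp
qed

text \<open>Replacing a ball by its \<kappa>-dilate multiplies its measure by \<kappa>^n, and this
  is all that the normalisation costs. The bound on the dilate then comes from the essential
  supremum itself.\<close>

lemma carleson_norm_le:
  fixes F F' :: "'a::euclidean_space \<times> real \<Rightarrow> ennreal"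
  assumes \<kappa>: "1 \<le> \<kappa>" and C: "0 < C" and q: "0 < enn2real q"
    and le: "\<And>c \<rho>. 0 < \<rho> \<Longrightarrow> (\<integral>\<^sup>+v\<in>tent (ball c \<rho>). epow (F' v) (enn2real q) / ennreal (snd v ^ 1) \<partial>lborel)
      \<le> ennreal C * (\<integral>\<^sup>+v\<in>tent (ball c (\<kappa> * \<rho>)). epow (F v) (enn2real q) / ennreal (snd v ^ 1) \<partial>lborel)"
  shows "ess_sup_on UNIV (carleson_fn q F')
    \<le> ennreal ((\<kappa> ^ DIM('a) * C) powr (1 / enn2real q)) * ess_sup_on UNIV (carleson_fn q F)"
proof -
  let ?r = "1 / enn2real q"
  have "carleson_fn q F' x \<le> ennreal ((\<kappa> ^ DIM('a) * C) powr ?r) * ess_sup_on UNIV (carleson_fn q F)" for x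
    unfolding carleson_fn_eq[of q F' x]
  proof (rule SUP_least, clarify)
    fix c :: 'a and \<rho> :: real assume \<rho>: "0 < \<rho>"
    let ?I' = "\<integral>\<^sup>+v\<in>tent (ball c \<rho>). epow (F' v) (enn2real q) / ennreal (snd v ^ 1) \<partial>lborel"
    let ?I = "\<integral>\<^sup>+v\<in>tent (ball c (\<kappa> * \<rho>)). epow (F v) (enn2real q) / ennreal (snd v ^ 1) \<partial>lborel"
    have \<kappa>\<rho>: "0 < \<kappa> * \<rho>" using \<kappa> \<rho> by simp
    define b where "b = unit_ball_vol (real DIM('a)) * \<rho> ^ DIM('a)"
    have b: "0 < b" "emeasure lborel (ball c \<rho>) = ennreal b"
      using \<rho> by (auto simp: b_def emeasure_ball)
    have b': "emeasure lborel (ball c (\<kappa> * \<rho>)) = ennreal (\<kappa> ^ DIM('a) * b)"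
      using \<kappa> \<rho> by (simp add: b_def emeasure_ball power_mult_distrib mult_ac)
    have "epow (emeasure lborel (ball c \<rho>)) (- 1 / enn2real q)
        = ennreal ((\<kappa> ^ DIM('a)) powr ?r) * epow (emeasure lborel (ball c (\<kappa> * \<rho>))) (- 1 / enn2real q)"
    proof -
      have "(\<kappa> ^ DIM('a)) powr ?r * (\<kappa> ^ DIM('a) * b) powr (- ?r) = b powr (- ?r)"
        using b \<kappa> by (simp add: powr_mult powr_minus field_simps)
      then show ?thesis using b \<kappa> by (simp add: b' epow_ennreal ennreal_mult[symmetric])
    qed
    moreover have "epow ?I' ?r \<le> ennreal (C powr ?r) * epow ?I ?r"
    proof -
      have "epow ?I' ?r \<le> epow (ennreal C * ?I) ?r"
        using q by (intro epow_mono le \<rho>) simp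
      then show ?thesis using C by (simp add: epow_mult epow_ennreal)
    qed
    ultimately have "epow (emeasure lborel (ball c \<rho>)) (- 1 / enn2real q) * epow ?I' ?r
       \<le> ennreal ((\<kappa> ^ DIM('a)) powr ?r) * epow (emeasure lborel (ball c (\<kappa> * \<rho>))) (- 1 / enn2real q)
          * (ennreal (C powr ?r) * epow ?I ?r)"
      by (simp only: mult_left_mono zero_le)
    also have "\<dots> = ennreal ((\<kappa> ^ DIM('a) * C) powr ?r) *
        (epow (emeasure lborel (ball c (\<kappa> * \<rho>))) (- 1 / enn2real q) * epow ?I ?r)"
      using \<kappa> C by (simp add: powr_mult ennreal_mult mult_ac)
    also have "\<dots> \<le> ennreal ((\<kappa> ^ DIM('a) * C) powr ?r) * ess_sup_on UNIV (carleson_fn q F)"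
      by (intro mult_left_mono carleson_ball_le \<kappa>\<rho>) simp
    finally show "epow (emeasure lborel (ball c \<rho>)) (- 1 / enn2real q) * epow ?I' ?r
      \<le> ennreal ((\<kappa> ^ DIM('a) * C) powr ?r) * ess_sup_on UNIV (carleson_fn q F)" .
  qed
  then show ?thesis by (simp add: ess_sup_on_le_iff)
qed

lemma Lp_norm_le:
  assumes p: "p \<noteq> top" and C: "0 < C"
    and le: "(\<integral>\<^sup>+x. epow (F x) (enn2real p) \<partial>lborel) \<le> ennreal C * (\<integral>\<^sup>+x. epow (G x) (enn2real p) \<partial>lborel)"
  shows "Lp_norm p F \<le> ennreal (C powr (1 / enn2real p)) * Lp_norm p G"
proof -
  have "epow (\<integral>\<^sup>+x. epow (F x) (enn2real p) \<partial>lborel) (1 / enn2real p)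
     \<le> epow (ennreal C * (\<integral>\<^sup>+x. epow (G x) (enn2real p) \<partial>lborel)) (1 / enn2real p)"
    using le by (rule epow_mono) simp
  then show ?thesis
    using p C by (simp add: Lp_norm_def nn_integral_completion epow_mult epow_ennreal)
qed

lemma Lp_norm_mono:
  assumes "\<And>x. F x \<le> G x"
  shows "Lp_norm p F \<le> Lp_norm p G"
  unfolding Lp_norm_def using assms
  by (auto intro!: epow_mono nn_integral_mono ess_sup_on_mono)

text \<open>G need not be measurable, so the constant cannot be pulled out on the right directly;
  dividing by C moves it to the measurable side. The intended G is an area functional of a Whitney
  average.\<close>

lemma nn_integral_le_cmult:
  assumes [measurable]: "F \<in> borel_measurable M" and C: "0 < C"
    and le: "\<And>x. F x \<le> ennreal C * G x"
  shows "(\<integral>\<^sup>+x. F x \<partial>M) \<le> ennreal C * (\<integral>\<^sup>+x. G x \<partial>M)"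
proof -
  have cancel: "ennreal C * (ennreal (1 / C) * u) = u" for u
    using C by (simp add: mult.assoc[symmetric] ennreal_mult[symmetric])
  have "ennreal (1 / C) * F x \<le> G x" for x
    using C mult_left_mono[OF le[of x], of "ennreal (1 / C)"]
    by (simp add: mult.assoc[symmetric] ennreal_mult[symmetric])
  then have "(\<integral>\<^sup>+x. ennreal (1 / C) * F x \<partial>M) \<le> (\<integral>\<^sup>+x. G x \<partial>M)"
    by (rule nn_integral_mono)
  then have "ennreal C * (ennreal (1 / C) * (\<integral>\<^sup>+x. F x \<partial>M)) \<le> ennreal C * (\<integral>\<^sup>+x. G x \<partial>M)"
    by (simp add: nn_integral_cmult mult_left_mono)
  then show ?thesis by (simp only: cancel)
qed

section \<open>Equivalence of the tent norms\<close>

definition wide_cone :: "real \<Rightarrow> 'a::euclidean_space \<Rightarrow> ('a \<times> real) set" where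
  "wide_cone a x = {(y, s). dist y x < a * s}"

lemma cone_eq_wide_cone: "cone x = wide_cone 1 x"
  by (simp add: cone_def wide_cone_def)

lemma wide_cone_measurable [measurable, simp]: "wide_cone a x \<in> sets borel"
  unfolding wide_cone_def case_prod_beta by (intro borel_open open_Collect_less continuous_intros)

lemma cone_measurable [measurable]: "cone x \<in> sets borel" for x :: "'a::euclidean_space"
  by (simp add: cone_eq_wide_cone)

lemma aperture_int_wide_cone: "aperture_int a g x = (\<integral>\<^sup>+w\<in>wide_cone a x. g w \<partial>lborel)"
  by (simp add: aperture_int_def wide_cone_def)

text \<open>An essential supremum exceeds l iff {F > l} meets the cone in positive measure. This
  makes the maximal functional accessible to the results on cone integrals, its measurability
  included.\<close>

lemma level_set_ess_sup_on_wide_cone: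
  fixes F :: "'a::euclidean_space \<times> real \<Rightarrow> ennreal"
  assumes [measurable]: "F \<in> borel_measurable borel"
  shows "{x. l < ess_sup_on (wide_cone a x) F} = {x. 0 < aperture_int a (indicator {v. l < F v}) x}"
proof -
  have "ess_sup_on (wide_cone a x) F \<le> l \<longleftrightarrow> aperture_int a (indicator {v. l < F v}) x = 0" for x
  proof -
    have "aperture_int a (indicator {v. l < F v}) x = 0 \<longleftrightarrow>
        (AE v in lborel. indicator {v. l < F v} v * indicator (wide_cone a x) v = (0::ennreal))"
      unfolding aperture_int_wide_cone by (rule nn_integral_0_iff_AE) measurable
    also have "\<dots> \<longleftrightarrow> ess_sup_on (wide_cone a x) F \<le> l"
      unfolding ess_sup_on_le_iff AE_lebesgue_iff by (intro AE_cong) (auto simp: indicator_def)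
    finally show ?thesis by simp
  qed
  then show ?thesis by (auto simp: not_le[symmetric] zero_less_iff_neq_zero)
qed

lemma measurable_ess_sup_on_wide_cone [measurable]:
  fixes F :: "'a::euclidean_space \<times> real \<Rightarrow> ennreal"
  assumes [measurable]: "F \<in> borel_measurable borel"
  shows "(\<lambda>x. ess_sup_on (wide_cone a x) F) \<in> borel_measurable borel"
proof (rule borel_measurableI_greater)
  fix l
  have "{x. 0 < aperture_int a (indicator {v. l < F v}) x} \<in> sets borel" by measurable
  then show "{x \<in> space borel. l < ess_sup_on (wide_cone a x) F} \<in> sets borel"
    by (simp add: level_set_ess_sup_on_wide_cone)
qed

text \<open>The level sets compare at each height with one and the same factor, so every r > 0 is
  covered without a case distinction and with a constant independent of r.\<close>

lemma nn_integral_epow_ess_sup_on_wide_cone: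
  fixes F :: "'a::euclidean_space \<times> real \<Rightarrow> ennreal"
  assumes [measurable]: "F \<in> borel_measurable borel" and a: "1 \<le> a" and r: "0 < r"
  shows "(\<integral>\<^sup>+x. epow (ess_sup_on (wide_cone a x) F) r \<partial>lborel)
    \<le> ennreal (2 * a ^ DIM('a) * 5 ^ DIM('a)) * (\<integral>\<^sup>+x. epow (ess_sup_on (wide_cone 1 x) F) r \<partial>lborel)"
proof (rule nn_integral_epow_le_of_distribution[where
      \<Phi> = "\<lambda>t u. ennreal (2 * a ^ DIM('a) * 5 ^ DIM('a)) * (ennreal t * indicator {v. ennreal t < v} u)"])
  let ?k = "2 * a ^ DIM('a) * 5 ^ DIM('a)" and ?N = "\<lambda>x. ess_sup_on (wide_cone 1 x) F"
  fix t :: real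
  have "ennreal t * emeasure lborel {x. ennreal t < ess_sup_on (wide_cone a x) F}
     \<le> ennreal t * (ennreal ?k * emeasure lborel {x. ennreal t < ?N x})"
    unfolding level_set_ess_sup_on_wide_cone[OF assms(1)]
    using a by (intro mult_left_mono aperture_int_support) auto
  also have "\<dots> = ennreal ?k * (ennreal t * emeasure lborel {x. ennreal t < ?N x})"
    by (rule mult.left_commute)
  also have "\<dots> = (\<integral>\<^sup>+x. ennreal ?k * (ennreal t * indicator {x. ennreal t < ?N x} x) \<partial>lborel)"
    by (simp add: nn_integral_cmult)
  also have "\<dots> = (\<integral>\<^sup>+x. ennreal ?k * (ennreal t * indicator {v. ennreal t < v} (?N x)) \<partial>lborel)"
    by (simp add: indicator_def)
  finally show "ennreal t * emeasure lborel {x. ennreal t < ess_sup_on (wide_cone a x) F}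
     \<le> (\<integral>\<^sup>+x. ennreal ?k * (ennreal t * indicator {v. ennreal t < v} (?N x)) \<partial>lborel)" .
next
  let ?k = "2 * a ^ DIM('a) * 5 ^ DIM('a)"
  fix u :: ennreal
  let ?f = "\<lambda>t. ennreal (r * t powr (r - 2)) * (ennreal t * indicator {v. ennreal t < v} u) * indicator {0<..} t"
  have "(\<integral>\<^sup>+t\<in>{0<..}. ennreal (r * t powr (r - 2)) * (ennreal ?k * (ennreal t * indicator {v. ennreal t < v} u)) \<partial>lborel)
     = (\<integral>\<^sup>+t. ennreal ?k * ?f t \<partial>lborel)"
    by (simp only: mult_ac)
  also have "\<dots> = ennreal ?k * (\<integral>\<^sup>+t. ?f t \<partial>lborel)"
    by (rule nn_integral_cmult) measurable
  also have "(\<integral>\<^sup>+t. ?f t \<partial>lborel) = epow u r"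
    by (rule nn_integral_below_level[OF r])
  finally show "(\<integral>\<^sup>+t\<in>{0<..}. ennreal (r * t powr (r - 2)) *
      (ennreal ?k * (ennreal t * indicator {v. ennreal t < v} u)) \<partial>lborel) \<le> ennreal ?k * epow u r"
    by simp
qed (measurable, use r in simp)

lemma ess_sup_on_cover:
  assumes "countable D" and le: "\<And>w. w \<in> D \<Longrightarrow> ess_sup_on (S w) F \<le> C" and A: "A \<subseteq> (\<Union>w\<in>D. S w)"
  shows "ess_sup_on A F \<le> C"
proof -
  have "AE x in lebesgue. \<forall>w\<in>D. x \<in> S w \<longrightarrow> F x \<le> C"
    using assms(1) le by (subst AE_ball_countable) (auto simp: ess_sup_on_le_iff)
  then show ?thesis
    unfolding ess_sup_on_le_iff using A by (elim eventually_mono) blast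
qed

lemma enn2real_pos: "0 < p \<Longrightarrow> p < top \<Longrightarrow> 0 < enn2real p"
  by (simp add: enn2real_positive_iff)

section \<open>Whitney boxes in relation to cones and tents\<close>

context whitney_parameters
begin

lemma whitney_avg_top: "whitney_avg \<alpha>1 \<alpha>2 top F w = ess_sup_on (whitney \<alpha>1 \<alpha>2 w) F"
  by (simp add: whitney_avg_def)

lemma epow_whitney_avg:
  fixes F :: "'a::euclidean_space \<times> real \<Rightarrow> ennreal"
  assumes "0 < q" "q < top"
  shows "epow (whitney_avg \<alpha>1 \<alpha>2 q F w) (enn2real q) = solid_avg (\<lambda>v. epow (F v) (enn2real q)) w"
proof -
  have "whitney \<alpha>1 \<alpha>2 w \<in> sets borel"
    by (cases w) (simp add: whitney_eq_Times borel_Times)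
  then show ?thesis
    using less_imp_neq[OF assms(2)] enn2real_pos[OF assms]
    by (simp add: whitney_avg_def solid_avg_def nn_integral_completion)
qed

lemma mem_whitney_self: "0 < snd v \<Longrightarrow> v \<in> whitney \<alpha>1 \<alpha>2 v"
  using \<alpha>1 \<alpha>2 by (simp add: mem_whitney divide_less_eq)

lemma open_whitney: "open (whitney \<alpha>1 \<alpha>2 w)"
  by (cases w) (simp add: whitney_eq_Times open_Times)

lemma open_whitney_vertices: "open {w. v \<in> whitney \<alpha>1 \<alpha>2 w}"
  unfolding mem_whitney by (intro open_Collect_conj open_Collect_less continuous_intros) (use \<alpha>2 in auto)

lemma ess_sup_on_whitney_avg_le:
  assumes "\<And>w. w \<in> U \<Longrightarrow> whitney \<alpha>1 \<alpha>2 w \<subseteq> V"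
  shows "ess_sup_on U (whitney_avg \<alpha>1 \<alpha>2 top F) \<le> ess_sup_on V F"
proof -
  have "whitney_avg \<alpha>1 \<alpha>2 top F w \<le> ess_sup_on V F" if "w \<in> U" for w
    unfolding whitney_avg_top ess_sup_on_le_iff using AE_ess_sup_on[of V F] assms[OF that]
    by (elim eventually_mono) blast
  then show ?thesis by (simp add: ess_sup_on_le_iff)
qed

text \<open>Almost every Whitney box centred in \<open>U\<close> obeys the bound, and each point of \<open>U\<close> lies in
  such a box; as the boxes are open, countably many of them suffice.\<close>
lemma ess_sup_on_le_whitney_avg:
  fixes U :: "('a::euclidean_space \<times> real) set"
  assumes U: "open U" "U \<subseteq> half_space"
  shows "ess_sup_on U F \<le> ess_sup_on U (whitney_avg \<alpha>1 \<alpha>2 top F)" (is "_ \<le> ?S")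
proof -
  define D where "D = {w \<in> U. ess_sup_on (whitney \<alpha>1 \<alpha>2 w) F \<le> ?S}"
  have cover: "U \<subseteq> (\<Union>w\<in>D. whitney \<alpha>1 \<alpha>2 w)"
  proof
    fix v assume v: "v \<in> U"
    \<comment> \<open>The centres in U whose box contains v. Being open and containing v, this set
      has positive measure and so cannot miss the centres at which the bound holds.\<close>
    let ?O = "U \<inter> {w. v \<in> whitney \<alpha>1 \<alpha>2 w}"
    have O: "open ?O" using U(1) open_whitney_vertices by (rule open_Int)
    have "v \<in> ?O" using v U(2) by (auto simp: half_space_def intro!: mem_whitney_self)
    have "\<exists>w\<in>?O. ess_sup_on (whitney \<alpha>1 \<alpha>2 w) F \<le> ?S"
    proof (rule ccontr)
      assume neg: "\<not> ?thesis"
      have "AE w in lebesgue. w \<in> U \<longrightarrow> whitney_avg \<alpha>1 \<alpha>2 top F w \<le> ?S"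
        by (rule AE_ess_sup_on)
      then have ae: "AE w in lborel. w \<notin> ?O"
        unfolding AE_lebesgue_iff by eventually_elim (use neg in \<open>auto simp: whitney_avg_top\<close>)
      have sets: "?O \<in> sets lborel" "{w \<in> space lborel. \<not> w \<notin> ?O} = ?O"
        using borel_open[OF O] by auto
      have "emeasure lborel ?O = 0"
        using ae AE_iff_measurable[OF sets] by (simp only:)
      moreover obtain e where e: "0 < e" "ball v e \<subseteq> ?O"
        using O \<open>v \<in> ?O\<close> open_contains_ball by blast
      ultimately have "emeasure lborel (ball v e) = 0"
        using emeasure_mono[OF e(2), of lborel] borel_open[OF O] by simp
      then show False using emeasure_ball_pos_finite[OF e(1), of v] by simp
    qed
    then show "v \<in> (\<Union>w\<in>D. whitney \<alpha>1 \<alpha>2 w)" by (auto simp: D_def)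
  qed
  obtain D' where D': "D' \<subseteq> D" "countable D'" "(\<Union>w\<in>D'. whitney \<alpha>1 \<alpha>2 w) = (\<Union>w\<in>D. whitney \<alpha>1 \<alpha>2 w)"
  proof -
    obtain \<F> where \<F>: "\<F> \<subseteq> whitney \<alpha>1 \<alpha>2 ` D" "countable \<F>" "\<Union>\<F> = (\<Union>w\<in>D. whitney \<alpha>1 \<alpha>2 w)"
      using Lindelof[of "whitney \<alpha>1 \<alpha>2 ` D"] open_whitney by blast
    then obtain D' where "D' \<subseteq> D" "countable D'" "\<F> = whitney \<alpha>1 \<alpha>2 ` D'"
      by (metis countable_subset_image)
    with \<F> that show ?thesis by blast
  qed
  show ?thesis
  proof (rule ess_sup_on_cover[of D' "whitney \<alpha>1 \<alpha>2"])
    show "U \<subseteq> (\<Union>w\<in>D'. whitney \<alpha>1 \<alpha>2 w)" using cover D'(3) by simp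
    show "ess_sup_on (whitney \<alpha>1 \<alpha>2 w) F \<le> ?S" if "w \<in> D'" for w
      using that D'(1) unfolding D_def by blast
  qed (rule D'(2))
qed

text \<open>The aperture is the product of two losses: horizontally |z - x| < (1 + \<alpha>1) t, and
  t < \<alpha>2 s when the height is changed.\<close>

lemma whitney_subset_wide_cone:
  fixes x :: "'a::euclidean_space"
  assumes "w \<in> cone x"
  shows "whitney \<alpha>1 \<alpha>2 w \<subseteq> wide_cone ((1 + \<alpha>1) * \<alpha>2) x"
proof
  fix v assume v: "v \<in> whitney \<alpha>1 \<alpha>2 w"
  obtain y t z s where [simp]: "w = (y, t)" "v = (z, s)" by (cases w; cases v)
  have "dist z x \<le> dist z y + dist y x" by (rule dist_triangle)
  also have "\<dots> < (1 + \<alpha>1) * t"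
    using assms v by (auto simp: cone_def mem_whitney algebra_simps)
  also have "\<dots> < (1 + \<alpha>1) * (\<alpha>2 * s)"
    using v \<alpha>1 \<alpha>2 by (intro mult_strict_left_mono) (auto simp: mem_whitney divide_less_eq mult.commute)
  finally show "v \<in> wide_cone ((1 + \<alpha>1) * \<alpha>2) x" by (simp add: wide_cone_def mult.assoc)
qed

text \<open>Since t \<le> \<rho> in the tent, the box moves horizontally by at most \<alpha>1 \<rho>
  and reaches height at most \<alpha>2 \<rho>. The same dilation factor serves the reverse inclusion
  below.\<close>

lemma whitney_subset_tent:
  fixes c :: "'a::euclidean_space"
  assumes w: "w \<in> tent (ball c \<rho>)"
  shows "whitney \<alpha>1 \<alpha>2 w \<subseteq> tent (ball c ((1 + \<alpha>1 + \<alpha>2) * \<rho>))"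
proof
  fix v assume v: "v \<in> whitney \<alpha>1 \<alpha>2 w"
  obtain y t z s where [simp]: "w = (y, t)" "v = (z, s)" by (cases w; cases v)
  have t: "0 < t" "dist y c + t \<le> \<rho>" using w by (simp_all add: mem_tent_ball)
  have vs: "dist z y < \<alpha>1 * t" "t / \<alpha>2 < s" "s < \<alpha>2 * t" using v by (simp_all add: mem_whitney)
  have "t \<le> \<rho>" using t zero_le_dist[of y c] by linarith
  then have "\<alpha>1 * t \<le> \<alpha>1 * \<rho>" "\<alpha>2 * t \<le> \<alpha>2 * \<rho>" using \<alpha>1 \<alpha>2 by (auto intro: mult_left_mono)
  moreover have "dist z c \<le> dist z y + dist y c" by (rule dist_triangle)
  ultimately have "dist z c + s \<le> \<rho> + \<alpha>1 * \<rho> + \<alpha>2 * \<rho>" using vs t by linarith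
  moreover have "0 < t / \<alpha>2" using t \<alpha>2 by simp
  ultimately show "v \<in> tent (ball c ((1 + \<alpha>1 + \<alpha>2) * \<rho>))"
    using vs by (simp add: mem_tent_ball algebra_simps)
qed

text \<open>The centre \<open>c\<close> moves \<open>z\<close> towards the vertex \<open>x\<close>, so that the ball around it stays both
  in the cone and in the set of admissible Whitney centres.\<close>
lemma ball_subset_cone_whitney:
  fixes x :: "'a::euclidean_space"
  assumes v: "v \<in> cone x"
  shows "\<exists>c. ball c (\<alpha>1 * snd v / 2) \<times> {snd v<..<\<alpha>2 * snd v} \<subseteq> {w \<in> cone x. v \<in> whitney \<alpha>1 \<alpha>2 w}"
proof -
  obtain z s where [simp]: "v = (z, s)" by (cases v)
  have zx: "dist z x < s" using v by (simp add: cone_def)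
  then have s: "0 < s" using zero_le_dist[of z x] by linarith
  define c where "c = z + (\<alpha>1 / 2) *\<^sub>R (x - z)"
  have "c - z = (\<alpha>1 / 2) *\<^sub>R (x - z)" "c - x = (1 - \<alpha>1 / 2) *\<^sub>R (z - x)"
    by (simp_all add: c_def algebra_simps)
  then have "dist z c = \<alpha>1 / 2 * dist z x" "dist c x = (1 - \<alpha>1 / 2) * dist z x"
    using \<alpha>1 \<alpha>1_less by (simp_all add: dist_norm norm_minus_commute)
  moreover have "\<alpha>1 / 2 * dist z x \<le> \<alpha>1 / 2 * s" "(1 - \<alpha>1 / 2) * dist z x \<le> (1 - \<alpha>1 / 2) * s"
    using zx \<alpha>1 \<alpha>1_less by (auto intro!: mult_left_mono)
  ultimately have c: "dist z c \<le> \<alpha>1 * s / 2" "dist c x \<le> s - \<alpha>1 * s / 2"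
    by (simp_all add: algebra_simps)
  have "ball c (\<alpha>1 * s / 2) \<times> {s<..<\<alpha>2 * s} \<subseteq> {w \<in> cone x. v \<in> whitney \<alpha>1 \<alpha>2 w}"
  proof
    fix w assume w: "w \<in> ball c (\<alpha>1 * s / 2) \<times> {s<..<\<alpha>2 * s}"
    obtain y t where [simp]: "w = (y, t)" by (cases w)
    have yt: "dist c y < \<alpha>1 * s / 2" "s < t" "t < \<alpha>2 * s" using w by auto
    have "dist y x \<le> dist c y + dist c x" by (rule dist_triangle3)
    then have "dist y x < t" using c yt by linarith
    have "dist z y \<le> dist z c + dist c y" by (rule dist_triangle)
    then have "dist z y < \<alpha>1 * s" using c yt by linarith
    also have "\<dots> \<le> \<alpha>1 * t" using \<alpha>1 yt by (intro mult_left_mono) auto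
    finally have "dist z y < \<alpha>1 * t" .
    moreover have "s < \<alpha>2 * t"
    proof -
      have "1 * t < \<alpha>2 * t" using \<alpha>2 s yt by (intro mult_strict_right_mono) auto
      then show ?thesis using yt by linarith
    qed
    moreover have "t / \<alpha>2 < s" using yt \<alpha>2 by (simp add: divide_less_eq mult.commute)
    ultimately show "w \<in> {w \<in> cone x. v \<in> whitney \<alpha>1 \<alpha>2 w}"
      using \<open>dist y x < t\<close> by (simp add: cone_def mem_whitney)
  qed
  then show ?thesis by auto
qed

text \<open>The larger tent leaves room on all sides, so the ball of centres can sit directly at the
  base point of v, without the shift that a fixed cone requires.\<close>

lemma ball_subset_tent_whitney:
  fixes c :: "'a::euclidean_space"
  assumes v: "v \<in> tent (ball c \<rho>)"
  shows "ball (fst v) (\<alpha>1 * snd v / 2) \<times> {snd v<..<\<alpha>2 * snd v}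
    \<subseteq> {w \<in> tent (ball c ((1 + \<alpha>1 + \<alpha>2) * \<rho>)). v \<in> whitney \<alpha>1 \<alpha>2 w}"
proof
  obtain z s where [simp]: "v = (z, s)" by (cases v)
  have s: "0 < s" "dist z c + s \<le> \<rho>" using v by (simp_all add: mem_tent_ball)
  fix w assume w: "w \<in> ball (fst v) (\<alpha>1 * snd v / 2) \<times> {snd v<..<\<alpha>2 * snd v}"
  obtain y t where [simp]: "w = (y, t)" by (cases w)
  have yt: "dist z y < \<alpha>1 * s / 2" "s < t" "t < \<alpha>2 * s" using w by auto
  have \<alpha>s: "0 < \<alpha>1 * s" using \<alpha>1 s by simp
  have "\<alpha>1 * s \<le> \<alpha>1 * t" using \<alpha>1 yt by (intro mult_left_mono) auto
  then have "dist z y < \<alpha>1 * t" using yt \<alpha>s by linarith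
  moreover have "s < \<alpha>2 * t"
  proof -
    have "1 * t < \<alpha>2 * t" using \<alpha>2 s yt by (intro mult_strict_right_mono) auto
    then show ?thesis using yt by linarith
  qed
  moreover have "t / \<alpha>2 < s" using yt \<alpha>2 by (simp add: divide_less_eq mult.commute)
  moreover have "dist y c + t \<le> (1 + \<alpha>1 + \<alpha>2) * \<rho>"
  proof -
    have "s \<le> \<rho>" using s zero_le_dist[of z c] by linarith
    then have "\<alpha>1 * s \<le> \<alpha>1 * \<rho>" "\<alpha>2 * s \<le> \<alpha>2 * \<rho>" using \<alpha>1 \<alpha>2 by (auto intro: mult_left_mono)
    moreover have "dist y c \<le> dist z y + dist z c" by (rule dist_triangle3)
    ultimately have "dist y c + t \<le> \<rho> + \<alpha>1 * \<rho> + \<alpha>2 * \<rho>" using s yt \<alpha>s by linarith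
    then show ?thesis by (simp add: algebra_simps)
  qed
  ultimately show "w \<in> {w \<in> tent (ball c ((1 + \<alpha>1 + \<alpha>2) * \<rho>)). v \<in> whitney \<alpha>1 \<alpha>2 w}"
    using s yt by (simp add: mem_tent_ball mem_whitney)
qed

end

section \<open>Invariance under changes on null sets\<close>

lemma area_fn_eq_cone:
  fixes F :: "'a::euclidean_space \<times> real \<Rightarrow> ennreal"
  shows "area_fn q F x = epow (\<integral>\<^sup>+v\<in>cone x. epow (F v) (enn2real q) / ennreal (snd v ^ (DIM('a) + 1)) \<partial>lborel)
    (1 / enn2real q)"
  by (simp add: area_fn_eq aperture_int_wide_cone cone_eq_wide_cone)

lemma whitney_avg_cong_AE:
  assumes "AE v in lebesgue. F v = F' v"
  shows "whitney_avg \<alpha>1 \<alpha>2 q F = whitney_avg \<alpha>1 \<alpha>2 q F'"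
proof -
  have "(\<integral>\<^sup>+v\<in>whitney \<alpha>1 \<alpha>2 w. epow (F v) (enn2real q) \<partial>lebesgue)
      = (\<integral>\<^sup>+v\<in>whitney \<alpha>1 \<alpha>2 w. epow (F' v) (enn2real q) \<partial>lebesgue)" for w
    using assms by (intro nn_integral_cong_AE) (auto elim: eventually_mono)
  then show ?thesis
    unfolding whitney_avg_def using ess_sup_on_cong_AE[OF assms] by presburger
qed

lemma tent_norm_cong_AE:
  fixes F :: "'a::euclidean_space \<times> real \<Rightarrow> ennreal"
  assumes "AE v in lebesgue. F v = F' v"
  shows "tent_norm p q F = tent_norm p q F'"
proof -
  have ae: "AE v in lborel. F v = F' v" using assms by (simp add: AE_lebesgue_iff)
  have int: "(\<integral>\<^sup>+v\<in>A. epow (F v) r / ennreal (snd v ^ k) \<partial>lborel)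
    = (\<integral>\<^sup>+v\<in>A. epow (F' v) r / ennreal (snd v ^ k) \<partial>lborel)" for A r k
    using ae by (intro nn_integral_cong_AE) (auto elim: eventually_mono)
  have "area_fn q F = area_fn q F'" "carleson_fn q F = carleson_fn q F'"
    by (simp_all only: fun_eq_iff area_fn_eq_cone carleson_fn_eq int simp_thms)
  moreover have "ntmax_fn F = ntmax_fn F'"
    unfolding ntmax_fn_def using ess_sup_on_cong_AE[OF assms] by presburger
  ultimately show ?thesis
    unfolding tent_norm_def using ess_sup_on_cong_AE[OF assms] by presburger
qed

section \<open>The two inequalities in each range of exponents\<close>

context whitney_parameters
begin

text \<open>At each vertex the area functional of the average is controlled by a cone of aperture a,
  with the kernel constant for k = n + 1. Changing the aperture at exponent r = p/q returns to the
  standard cone.\<close>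

lemma area_norm_whitney_avg_le:
  assumes p: "0 < p" "p < top" and q: "0 < q" "q < top"
  shows "\<exists>C>0. \<forall>F :: 'a::euclidean_space \<times> real \<Rightarrow> ennreal. F \<in> borel_measurable borel \<longrightarrow>
    Lp_norm p (area_fn q (whitney_avg \<alpha>1 \<alpha>2 q F)) \<le> ennreal C * Lp_norm p (area_fn q F)"
proof -
  define r where "r = 1 / enn2real q * enn2real p"
  have r: "0 < r" using enn2real_pos p q by (simp add: r_def)
  define a where "a = (1 + \<alpha>1) * \<alpha>2"
  have "1 * 1 \<le> a" unfolding a_def using \<alpha>1 \<alpha>2 by (intro mult_mono) auto
  then have a: "1 \<le> a" by simp
  define C0 where "C0 = \<alpha>2 ^ (2 * DIM('a) + 1 + (DIM('a) + 1))"
  have C0: "0 < C0" using \<alpha>2 by (simp add: C0_def)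
  obtain C where C: "0 < C" "\<And>g :: 'a \<times> real \<Rightarrow> ennreal. g \<in> borel_measurable borel \<Longrightarrow>
    (\<integral>\<^sup>+x. epow (aperture_int a g x) r \<partial>lborel) \<le> ennreal C * (\<integral>\<^sup>+x. epow (aperture_int 1 g x) r \<partial>lborel)"
    using change_of_aperture[OF a r] by blast
  show ?thesis
  proof (intro exI[of _ "(C0 powr r * C) powr (1 / enn2real p)"] conjI allI impI Lp_norm_le)
    fix F :: "'a \<times> real \<Rightarrow> ennreal" assume [measurable]: "F \<in> borel_measurable borel"
    define G where "G v = epow (F v) (enn2real q)" for v
    define g where "g v = G v / ennreal (snd v ^ (DIM('a) + 1))" for v
    have [measurable]: "G \<in> borel_measurable borel" "g \<in> borel_measurable borel"
      unfolding G_def g_def by measurable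
    have "(\<integral>\<^sup>+w\<in>cone x. solid_avg G w / ennreal (snd w ^ (DIM('a) + 1)) \<partial>lborel) \<le> ennreal C0 * aperture_int a g x" for x
      unfolding C0_def aperture_int_wide_cone g_def a_def
      by (intro nn_integral_solid_avg_le cone_subset_half_space whitney_subset_wide_cone) (simp_all add: cone_eq_wide_cone)
    then have "epow (area_fn q (whitney_avg \<alpha>1 \<alpha>2 q F) x) (enn2real p) \<le> epow (ennreal C0 * aperture_int a g x) r" for x
      unfolding area_fn_eq_cone epow_whitney_avg[OF q] epow_epow r_def[symmetric] G_def[symmetric]
      using r by (intro epow_mono) auto
    then have "(\<integral>\<^sup>+x. epow (area_fn q (whitney_avg \<alpha>1 \<alpha>2 q F) x) (enn2real p) \<partial>lborel)
      \<le> (\<integral>\<^sup>+x. ennreal (C0 powr r) * epow (aperture_int a g x) r \<partial>lborel)"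
      using C0 by (intro nn_integral_mono) (simp add: epow_mult epow_ennreal)
    also have "\<dots> = ennreal (C0 powr r) * (\<integral>\<^sup>+x. epow (aperture_int a g x) r \<partial>lborel)"
      by (rule nn_integral_cmult) measurable
    also have "\<dots> \<le> ennreal (C0 powr r) * (ennreal C * (\<integral>\<^sup>+x. epow (aperture_int 1 g x) r \<partial>lborel))"
      by (intro mult_left_mono C) auto
    also have "\<dots> = ennreal (C0 powr r * C) * (\<integral>\<^sup>+x. epow (area_fn q F x) (enn2real p) \<partial>lborel)"
    proof -
      have "g = (\<lambda>v. epow (F v) (enn2real q) / ennreal (snd v ^ (DIM('a) + 1)))"
        by (simp add: fun_eq_iff g_def G_def)
      then have "epow (area_fn q F x) (enn2real p) = epow (aperture_int 1 g x) r" for x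
        by (simp only: area_fn_eq epow_epow r_def)
      then show ?thesis using C(1) by (simp add: ennreal_mult mult.assoc)
    qed
    finally show "(\<integral>\<^sup>+x. epow (area_fn q (whitney_avg \<alpha>1 \<alpha>2 q F) x) (enn2real p) \<partial>lborel)
      \<le> ennreal (C0 powr r * C) * (\<integral>\<^sup>+x. epow (area_fn q F x) (enn2real p) \<partial>lborel)" .
  qed (use p C C0 in auto)
qed

text \<open>Already a pointwise bound at each vertex over the same cone, which is why the constant
  contains no maximal inequality.\<close>

lemma area_norm_le_whitney_avg:
  assumes p: "0 < p" "p < top" and q: "0 < q" "q < top"
  shows "\<exists>C>0. \<forall>F :: 'a::euclidean_space \<times> real \<Rightarrow> ennreal. F \<in> borel_measurable borel \<longrightarrow>
    Lp_norm p (area_fn q F) \<le> ennreal C * Lp_norm p (area_fn q (whitney_avg \<alpha>1 \<alpha>2 q F))"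
proof -
  define r where "r = 1 / enn2real q * enn2real p"
  have r: "0 < r" using enn2real_pos p q by (simp add: r_def)
  obtain C where C: "0 < C" "\<And>(G :: 'a \<times> real \<Rightarrow> ennreal) U V. G \<in> borel_measurable borel \<Longrightarrow> U \<in> sets borel \<Longrightarrow>
    V \<in> sets borel \<Longrightarrow> U \<subseteq> half_space \<Longrightarrow> V \<subseteq> half_space \<Longrightarrow>
    (\<forall>v\<in>V. \<exists>c. ball c (\<alpha>1 * snd v / 2) \<times> {snd v<..<\<alpha>2 * snd v} \<subseteq> {w\<in>U. v \<in> whitney \<alpha>1 \<alpha>2 w}) \<Longrightarrow>
    (\<integral>\<^sup>+v\<in>V. G v / ennreal (snd v ^ (DIM('a) + 1)) \<partial>lborel)
    \<le> ennreal C * (\<integral>\<^sup>+w\<in>U. solid_avg G w / ennreal (snd w ^ (DIM('a) + 1)) \<partial>lborel)"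
    using nn_integral_le_solid_avg[where 'a = 'a and k = "DIM('a) + 1"] by blast
  show ?thesis
  proof (intro exI[of _ "(C powr r) powr (1 / enn2real p)"] conjI allI impI Lp_norm_le)
    fix F :: "'a \<times> real \<Rightarrow> ennreal" assume [measurable]: "F \<in> borel_measurable borel"
    define G where "G v = epow (F v) (enn2real q)" for v
    have [measurable]: "G \<in> borel_measurable borel"
      unfolding G_def by measurable
    have "(\<integral>\<^sup>+v\<in>cone x. G v / ennreal (snd v ^ (DIM('a) + 1)) \<partial>lborel)
      \<le> ennreal C * (\<integral>\<^sup>+w\<in>cone x. solid_avg G w / ennreal (snd w ^ (DIM('a) + 1)) \<partial>lborel)" for x
      by (intro C ballI ball_subset_cone_whitney cone_subset_half_space cone_measurable) auto
    then have le: "epow (area_fn q F x) (enn2real p)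
      \<le> ennreal (C powr r) * epow (area_fn q (whitney_avg \<alpha>1 \<alpha>2 q F) x) (enn2real p)" for x
      unfolding area_fn_eq_cone epow_whitney_avg[OF q] epow_epow r_def[symmetric] G_def[symmetric]
      using r C(1) epow_mono[of _ "ennreal C * _" r] by (simp add: epow_mult epow_ennreal)
    have "(\<lambda>x. epow (area_fn q F x) (enn2real p)) \<in> borel_measurable lborel"
      unfolding area_fn_eq by measurable
    then show "(\<integral>\<^sup>+x. epow (area_fn q F x) (enn2real p) \<partial>lborel)
      \<le> ennreal (C powr r) * (\<integral>\<^sup>+x. epow (area_fn q (whitney_avg \<alpha>1 \<alpha>2 q F) x) (enn2real p) \<partial>lborel)"
      using C(1) le by (intro nn_integral_le_cmult) auto
  qed (use p C in auto)
qed

lemma carleson_norm_whitney_avg_le: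
  assumes q: "0 < q" "q < top"
  shows "\<exists>C>0. \<forall>F :: 'a::euclidean_space \<times> real \<Rightarrow> ennreal. F \<in> borel_measurable borel \<longrightarrow>
    ess_sup_on UNIV (carleson_fn q (whitney_avg \<alpha>1 \<alpha>2 q F)) \<le> ennreal C * ess_sup_on UNIV (carleson_fn q F)"
proof -
  let ?\<kappa> = "1 + \<alpha>1 + \<alpha>2" and ?C = "\<alpha>2 ^ (2 * DIM('a) + 1 + 1)"
  have pos: "1 \<le> ?\<kappa>" "0 < ?C" "0 < enn2real q" "0 < (?\<kappa> ^ DIM('a) * ?C) powr (1 / enn2real q)"
    using \<alpha>1 \<alpha>2 enn2real_pos[OF q] by (auto simp: zero_less_mult_iff)
  have "(\<integral>\<^sup>+v\<in>tent (ball c \<rho>). epow (whitney_avg \<alpha>1 \<alpha>2 q F v) (enn2real q) / ennreal (snd v ^ 1) \<partial>lborel)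
    \<le> ennreal ?C * (\<integral>\<^sup>+v\<in>tent (ball c (?\<kappa> * \<rho>)). epow (F v) (enn2real q) / ennreal (snd v ^ 1) \<partial>lborel)"
    if [measurable]: "F \<in> borel_measurable borel" for F :: "'a \<times> real \<Rightarrow> ennreal" and c \<rho>
    unfolding epow_whitney_avg[OF q]
    by (intro nn_integral_solid_avg_le tent_subset_half_space whitney_subset_tent) auto
  then have "ess_sup_on UNIV (carleson_fn q (whitney_avg \<alpha>1 \<alpha>2 q F))
      \<le> ennreal ((?\<kappa> ^ DIM('a) * ?C) powr (1 / enn2real q)) * ess_sup_on UNIV (carleson_fn q F)"
    if "F \<in> borel_measurable borel" for F :: "'a \<times> real \<Rightarrow> ennreal"
    using that by (intro carleson_norm_le pos)
  with pos(4) show ?thesis by blast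
qed

lemma carleson_norm_le_whitney_avg:
  assumes q: "0 < q" "q < top"
  shows "\<exists>C>0. \<forall>F :: 'a::euclidean_space \<times> real \<Rightarrow> ennreal. F \<in> borel_measurable borel \<longrightarrow>
    ess_sup_on UNIV (carleson_fn q F) \<le> ennreal C * ess_sup_on UNIV (carleson_fn q (whitney_avg \<alpha>1 \<alpha>2 q F))"
proof -
  let ?\<kappa> = "1 + \<alpha>1 + \<alpha>2"
  obtain C where C: "0 < C" "\<And>(G :: 'a \<times> real \<Rightarrow> ennreal) U V. G \<in> borel_measurable borel \<Longrightarrow> U \<in> sets borel \<Longrightarrow>
    V \<in> sets borel \<Longrightarrow> U \<subseteq> half_space \<Longrightarrow> V \<subseteq> half_space \<Longrightarrow>
    (\<forall>v\<in>V. \<exists>c. ball c (\<alpha>1 * snd v / 2) \<times> {snd v<..<\<alpha>2 * snd v} \<subseteq> {w\<in>U. v \<in> whitney \<alpha>1 \<alpha>2 w}) \<Longrightarrow>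
    (\<integral>\<^sup>+v\<in>V. G v / ennreal (snd v ^ 1) \<partial>lborel)
    \<le> ennreal C * (\<integral>\<^sup>+w\<in>U. solid_avg G w / ennreal (snd w ^ 1) \<partial>lborel)"
    using nn_integral_le_solid_avg[where 'a = 'a and k = 1] by blast
  have pos: "1 \<le> ?\<kappa>" "0 < enn2real q" "0 < (?\<kappa> ^ DIM('a) * C) powr (1 / enn2real q)"
    using \<alpha>1 \<alpha>2 C(1) enn2real_pos[OF q] by (auto simp: zero_less_mult_iff)
  have "(\<integral>\<^sup>+v\<in>tent (ball c \<rho>). epow (F v) (enn2real q) / ennreal (snd v ^ 1) \<partial>lborel)
      \<le> ennreal C * (\<integral>\<^sup>+v\<in>tent (ball c (?\<kappa> * \<rho>)). epow (whitney_avg \<alpha>1 \<alpha>2 q F v) (enn2real q) / ennreal (snd v ^ 1) \<partial>lborel)"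
    if [measurable]: "F \<in> borel_measurable borel" for F :: "'a \<times> real \<Rightarrow> ennreal" and c \<rho>
  proof -
    have "\<forall>v\<in>tent (ball c \<rho>). \<exists>c'. ball c' (\<alpha>1 * snd v / 2) \<times> {snd v<..<\<alpha>2 * snd v}
        \<subseteq> {w \<in> tent (ball c (?\<kappa> * \<rho>)). v \<in> whitney \<alpha>1 \<alpha>2 w}"
      using ball_subset_tent_whitney by blast
    then show ?thesis
      unfolding epow_whitney_avg[OF q] by (intro C tent_subset_half_space) auto
  qed
  then have "ess_sup_on UNIV (carleson_fn q F)
      \<le> ennreal ((?\<kappa> ^ DIM('a) * C) powr (1 / enn2real q)) * ess_sup_on UNIV (carleson_fn q (whitney_avg \<alpha>1 \<alpha>2 q F))"
    if "F \<in> borel_measurable borel" for F :: "'a \<times> real \<Rightarrow> ennreal"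
    using that by (intro carleson_norm_le pos C(1))
  with pos(3) show ?thesis by blast
qed

lemma ntmax_norm_whitney_avg_le:
  assumes p: "0 < p" "p < top"
  shows "\<exists>C>0. \<forall>F :: 'a::euclidean_space \<times> real \<Rightarrow> ennreal. F \<in> borel_measurable borel \<longrightarrow>
    Lp_norm p (ntmax_fn (whitney_avg \<alpha>1 \<alpha>2 top F)) \<le> ennreal C * Lp_norm p (ntmax_fn F)"
proof -
  define a where "a = (1 + \<alpha>1) * \<alpha>2"
  have "1 * 1 \<le> a" unfolding a_def using \<alpha>1 \<alpha>2 by (intro mult_mono) auto
  then have a: "1 \<le> a" by simp
  let ?C = "2 * a ^ DIM('a) * 5 ^ DIM('a)"
  have C: "0 < ?C" using a by simp
  show ?thesis
  proof (intro exI[of _ "?C powr (1 / enn2real p)"] conjI allI impI Lp_norm_le)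
    fix F :: "'a \<times> real \<Rightarrow> ennreal" assume [measurable]: "F \<in> borel_measurable borel"
    have "ntmax_fn (whitney_avg \<alpha>1 \<alpha>2 top F) x \<le> ess_sup_on (wide_cone a x) F" for x
      unfolding ntmax_fn_def a_def by (intro ess_sup_on_whitney_avg_le whitney_subset_wide_cone)
    then have "(\<integral>\<^sup>+x. epow (ntmax_fn (whitney_avg \<alpha>1 \<alpha>2 top F) x) (enn2real p) \<partial>lborel)
      \<le> (\<integral>\<^sup>+x. epow (ess_sup_on (wide_cone a x) F) (enn2real p) \<partial>lborel)"
      by (intro nn_integral_mono epow_mono) auto
    also have "\<dots> \<le> ennreal ?C * (\<integral>\<^sup>+x. epow (ess_sup_on (wide_cone 1 x) F) (enn2real p) \<partial>lborel)"
      using a enn2real_pos[OF p] by (intro nn_integral_epow_ess_sup_on_wide_cone) auto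
    finally show "(\<integral>\<^sup>+x. epow (ntmax_fn (whitney_avg \<alpha>1 \<alpha>2 top F) x) (enn2real p) \<partial>lborel)
      \<le> ennreal ?C * (\<integral>\<^sup>+x. epow (ntmax_fn F x) (enn2real p) \<partial>lborel)"
      by (simp only: ntmax_fn_def cone_eq_wide_cone)
  qed (use p C a in auto)
qed

lemma tent_norm_whitney_avg_le:
  assumes p: "0 < p" and q: "0 < q"
  shows "\<exists>C>0. \<forall>F :: 'a::euclidean_space \<times> real \<Rightarrow> ennreal. F \<in> borel_measurable borel \<longrightarrow>
    tent_norm p q (whitney_avg \<alpha>1 \<alpha>2 q F) \<le> ennreal C * tent_norm p q F"
proof -
  consider "p < top" "q < top" | "p = top" "q < top" | "p < top" "q = top" | "p = top" "q = top"
    using less_top by blast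
  then show ?thesis
  proof cases
    case 1
    then show ?thesis using area_norm_whitney_avg_le[OF p _ q] by (simp add: tent_norm_def)
  next
    case 2
    then show ?thesis using carleson_norm_whitney_avg_le[OF q] by (simp add: tent_norm_def Lp_norm_def)
  next
    case 3
    then show ?thesis using ntmax_norm_whitney_avg_le[OF p] by (simp add: tent_norm_def)
  next
    case 4
    have "whitney \<alpha>1 \<alpha>2 w \<subseteq> half_space" if "w \<in> half_space" for w :: "'a \<times> real"
    proof
      fix v assume "v \<in> whitney \<alpha>1 \<alpha>2 w"
      moreover have "0 < snd w / \<alpha>2" using that \<alpha>2 by (auto simp: half_space_def)
      ultimately show "v \<in> half_space" by (auto simp: mem_whitney half_space_def)
    qed
    then have "ess_sup_on half_space (whitney_avg \<alpha>1 \<alpha>2 top F) \<le> ess_sup_on half_space F" for F :: "'a \<times> real \<Rightarrow> ennreal"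
      by (rule ess_sup_on_whitney_avg_le)
    with 4 show ?thesis by (intro exI[of _ 1]) (simp add: tent_norm_def)
  qed
qed

lemma tent_norm_le_whitney_avg:
  assumes p: "0 < p" and q: "0 < q"
  shows "\<exists>C>0. \<forall>F :: 'a::euclidean_space \<times> real \<Rightarrow> ennreal. F \<in> borel_measurable borel \<longrightarrow>
    tent_norm p q F \<le> ennreal C * tent_norm p q (whitney_avg \<alpha>1 \<alpha>2 q F)"
proof -
  consider "p < top" "q < top" | "p = top" "q < top" | "p < top" "q = top" | "p = top" "q = top"
    using less_top by blast
  then show ?thesis
  proof cases
    case 1
    then show ?thesis using area_norm_le_whitney_avg[OF p _ q] by (simp add: tent_norm_def)
  next
    case 2
    then show ?thesis using carleson_norm_le_whitney_avg[OF q] by (simp add: tent_norm_def Lp_norm_def)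
  next
    case 3
    have "Lp_norm p (ntmax_fn F) \<le> Lp_norm p (ntmax_fn (whitney_avg \<alpha>1 \<alpha>2 top F))" for F :: "'a \<times> real \<Rightarrow> ennreal"
      unfolding ntmax_fn_def
      by (intro Lp_norm_mono ess_sup_on_le_whitney_avg open_cone cone_subset_half_space)
    with 3 show ?thesis by (intro exI[of _ 1]) (simp add: tent_norm_def)
  next
    case 4
    have "open (half_space :: ('a \<times> real) set)"
      unfolding half_space_def case_prod_beta by (intro open_Collect_less continuous_intros)
    then have "ess_sup_on half_space F \<le> ess_sup_on half_space (whitney_avg \<alpha>1 \<alpha>2 top F)" for F :: "'a \<times> real \<Rightarrow> ennreal"
      by (rule ess_sup_on_le_whitney_avg) simp
    with 4 show ?thesis by (intro exI[of _ 1]) (simp add: tent_norm_def)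
  qed
qed

end

theorem theorem2p2:
  fixes \<alpha>1 \<alpha>2 :: real and p q :: ennreal
  assumes "0 < \<alpha>1" "\<alpha>1 < 1 / \<alpha>2" "1 / \<alpha>2 < 1"
    and "0 < p" "0 < q"
  shows "\<exists>c C :: real. 0 < c \<and> c \<le> C \<and>
    (\<forall>(\<beta>::real) (f :: 'a::euclidean_space \<times> real \<Rightarrow> complex). f \<in> borel_measurable lebesgue \<longrightarrow>
       ennreal c * tent_norm_w p q \<beta> f \<le> tent_norm_whitney \<alpha>1 \<alpha>2 p q q \<beta> f \<and>
       tent_norm_whitney \<alpha>1 \<alpha>2 p q q \<beta> f \<le> ennreal C * tent_norm_w p q \<beta> f)"
proof -
  have "0 < 1 / \<alpha>2" using assms by linarith
  then have "0 < \<alpha>2" by simp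
  moreover have "\<alpha>1 < 1" using assms(2,3) by linarith
  ultimately interpret whitney_parameters \<alpha>1 \<alpha>2
    using assms(1,3) by unfold_locales (simp_all add: divide_less_eq)
  obtain C1 where C1: "0 < C1" "\<And>F :: 'a \<times> real \<Rightarrow> ennreal. F \<in> borel_measurable borel \<Longrightarrow>
    tent_norm p q (whitney_avg \<alpha>1 \<alpha>2 q F) \<le> ennreal C1 * tent_norm p q F"
    using tent_norm_whitney_avg_le[where 'a = 'a, OF assms(4,5)] by blast
  obtain C2 where C2: "0 < C2" "\<And>F :: 'a \<times> real \<Rightarrow> ennreal. F \<in> borel_measurable borel \<Longrightarrow>
    tent_norm p q F \<le> ennreal C2 * tent_norm p q (whitney_avg \<alpha>1 \<alpha>2 q F)"
    using tent_norm_le_whitney_avg[where 'a = 'a, OF assms(4,5)] by blast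
  show ?thesis
  \<comment> \<open>The lower constant is the reciprocal of \<open>C2\<close>; the maximum secures c
    \<le> C.\<close>
  proof (rule exI[of _ "1 / C2"], rule exI[of _ "max C1 (1 / C2)"], intro conjI allI impI)
    fix \<beta> :: real and f :: "'a \<times> real \<Rightarrow> complex"
    assume [measurable]: "f \<in> borel_measurable lebesgue"
    define F where "F = (\<lambda>(y, t). ennreal (cmod (f (y, t)) * t powr (- \<beta>)))"
    have "(\<lambda>v :: 'a \<times> real. snd v powr (- \<beta>)) \<in> borel_measurable lborel" by measurable
    then have [measurable]: "(\<lambda>v :: 'a \<times> real. snd v powr (- \<beta>)) \<in> borel_measurable lebesgue"
      by (rule measurable_completion)
    have "F = (\<lambda>v. ennreal (cmod (f v) * snd v powr (- \<beta>)))"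
      by (auto simp: F_def)
    then have "F \<in> borel_measurable lebesgue" by simp
    \<comment> \<open>The estimates above are for Borel functions, while f is only Lebesgue
      measurable. Both norms see only the almost everywhere class, and the Whitney averages of the
      two versions even agree at every centre.\<close>
    then obtain F' where F': "F' \<in> borel_measurable lborel" "AE v in lborel. F v = F' v"
      using completion_ex_borel_measurable by blast
    then have [measurable]: "F' \<in> borel_measurable borel" and ae: "AE v in lebesgue. F v = F' v"
      by (simp_all add: AE_lebesgue_iff)
    have w: "tent_norm_w p q \<beta> f = tent_norm p q F'"
      unfolding tent_norm_w_def F_def[symmetric] by (rule tent_norm_cong_AE[OF ae])
    have W: "tent_norm_whitney \<alpha>1 \<alpha>2 p q q \<beta> f = tent_norm p q (whitney_avg \<alpha>1 \<alpha>2 q F')"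
      unfolding tent_norm_whitney_def F_def[symmetric] by (simp only: whitney_avg_cong_AE[OF ae])
    have "ennreal (1 / C2) * tent_norm p q F'
        \<le> ennreal (1 / C2) * (ennreal C2 * tent_norm p q (whitney_avg \<alpha>1 \<alpha>2 q F'))"
      by (intro mult_left_mono C2) auto
    also have "\<dots> = tent_norm p q (whitney_avg \<alpha>1 \<alpha>2 q F')"
      using C2(1) by (simp add: mult.assoc[symmetric] ennreal_mult[symmetric])
    finally show "ennreal (1 / C2) * tent_norm_w p q \<beta> f \<le> tent_norm_whitney \<alpha>1 \<alpha>2 p q q \<beta> f"
      unfolding w W .
    have "tent_norm p q (whitney_avg \<alpha>1 \<alpha>2 q F') \<le> ennreal C1 * tent_norm p q F'"
      by (rule C1) simp
    also have "\<dots> \<le> ennreal (max C1 (1 / C2)) * tent_norm p q F'"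
      by (intro mult_right_mono ennreal_leI) auto
    finally show "tent_norm_whitney \<alpha>1 \<alpha>2 p q q \<beta> f \<le> ennreal (max C1 (1 / C2)) * tent_norm_w p q \<beta> f"
      unfolding w W .
  qed (use C2 in auto)
qed

end
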